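(* Let $n>1$, let $T\in\mathcal{T}_n$ with diagonal rings $T_1,\dots,T_n$ and off-diagonal bimodules $M_{ij}$, and let $R=\mathcal{D}(T)$. For $k=1,\dots,n$ let $$\mathcal{E}_k=\{[t_{ij}]\in T \mid t_{kj}\in M_{kj}\text{ for } j\neq k,\ t_{kk}=1\in T_k,\ \text{and all other entries are zero}\},$$ and let $\mathcal{E}=\bigcup_{k=1}^n\mathcal{E}_k$. Then: (1) The subring $\langle R\cup\mathcal{E}\rangle_T$ of $T$ generated by $R\cup\mathcal{E}$ equals $T$. (2) If $\mathcal{C}$ is a property of rings such that a ring $A$ has $\mathcal{C}$ if and only if every prime factor of $A$ has $\mathcal{C}$, then $R$ has property $\mathcal{C}$ if and only if $T$ has property $\mathcal{C}$. (3) $\rho(R)=\rho(T)\cap R$ for any special radical $\rho$. (4) The classical Krull dimensions of $R$ and $T$ are equal.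
   Context: All rings are associative with unity and modules are unital. An $n$-by-$n$ generalized matrix ring is a square array with rings $R_i$ on the diagonal and $(R_i,R_j)$-bimodules $M_{ij}$ in the $(i,j)$-positions ($i\neq j$, $M_{ii}=R_i$), together with $(R_i,R_k)$-bimodule homomorphisms $\theta_{ijk}:M_{ij}\otimes_{R_j}M_{jk}\to M_{ik}$, written $m_{ij}m_{jk}=\theta_{ijk}(m_{ij}\otimes m_{jk})$, satisfying $(m_{ij}m_{jk})m_{kl}=m_{ij}(m_{jk}m_{kl})$ for all indices; $\theta_{iii}$ is the multiplication of $R_i$, and $\theta_{ijj},\theta_{jjk}$ are the scalar multiplications. Addition is componentwise and multiplication is row-column matrix multiplication. For $n>1$, $\mathcal{T}_n$ is the class of $n$-by-$n$ generalized matrix rings with $\theta_{iji}=0$ for all $i\neq j$. $\mathcal{D}(T)=\{[t_{ij}]\in T\mid t_{ij}=0\text{ for all } i\neq j\}$. A prime factor of $A$ is $A/P$ with $P$ a prime ideal; properties of rings are understood to be isomorphism-invariant. A special class $\mathcal{M}$ is a class of prime rings (not necessarily with unity), closed under isomorphism and ideals, such that if $I$ is an essential ideal of $A$ and $I\in\mathcal{M}$ then $A\in\mathcal{M}$; the associated special radical satisfies $\rho(A)=\bigcap\{I\trianglelefteq A\mid A/I\in\mathcal{M}\}$. The classical Krull dimension is the one defined through chains of prime ideals. *)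

theory Defs
  imports "HOL-Algebra.Free_Abelian_Groups" "HOL-Algebra.Ideal_Product"
    "HOL-Algebra.Generated_Rings" "HOL-Library.Extended_Real"
begin

section \<open>Bimodules and their tensor products\<close>

text \<open>As for \<open>module\<close> in \<open>HOL-Algebra\<close>, the record extends \<open>ring\<close>, but of the ring
  fields only the carrier, addition and zero are significant.\<close>

record ('r, 's, 'm) bimodule = "'m ring" +
  lsmult :: "'r \<Rightarrow> 'm \<Rightarrow> 'm"
  rsmult :: "'m \<Rightarrow> 's \<Rightarrow> 'm"

locale bimodule = R: ring R + S: ring S + M: abelian_group M
  for R :: "('r, 'c) ring_scheme" and S :: "('s, 'd) ring_scheme"
    and M :: "('r, 's, 'm, 'e) bimodule_scheme" +
  assumes lsmult_closed:
      "\<lbrakk>r \<in> carrier R; x \<in> carrier M\<rbrakk> \<Longrightarrow> lsmult M r x \<in> carrier M"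
    and rsmult_closed:
      "\<lbrakk>x \<in> carrier M; s \<in> carrier S\<rbrakk> \<Longrightarrow> rsmult M x s \<in> carrier M"
    and lsmult_l_distr:
      "\<lbrakk>r \<in> carrier R; r' \<in> carrier R; x \<in> carrier M\<rbrakk>
        \<Longrightarrow> lsmult M (r \<oplus>\<^bsub>R\<^esub> r') x = lsmult M r x \<oplus>\<^bsub>M\<^esub> lsmult M r' x"
    and lsmult_r_distr:
      "\<lbrakk>r \<in> carrier R; x \<in> carrier M; y \<in> carrier M\<rbrakk>
        \<Longrightarrow> lsmult M r (x \<oplus>\<^bsub>M\<^esub> y) = lsmult M r x \<oplus>\<^bsub>M\<^esub> lsmult M r y"
    and rsmult_l_distr:
      "\<lbrakk>x \<in> carrier M; y \<in> carrier M; s \<in> carrier S\<rbrakk>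
        \<Longrightarrow> rsmult M (x \<oplus>\<^bsub>M\<^esub> y) s = rsmult M x s \<oplus>\<^bsub>M\<^esub> rsmult M y s"
    and rsmult_r_distr:
      "\<lbrakk>x \<in> carrier M; s \<in> carrier S; s' \<in> carrier S\<rbrakk>
        \<Longrightarrow> rsmult M x (s \<oplus>\<^bsub>S\<^esub> s') = rsmult M x s \<oplus>\<^bsub>M\<^esub> rsmult M x s'"
    and lsmult_assoc:
      "\<lbrakk>r \<in> carrier R; r' \<in> carrier R; x \<in> carrier M\<rbrakk>
        \<Longrightarrow> lsmult M (r \<otimes>\<^bsub>R\<^esub> r') x = lsmult M r (lsmult M r' x)"
    and rsmult_assoc:
      "\<lbrakk>x \<in> carrier M; s \<in> carrier S; s' \<in> carrier S\<rbrakk>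
        \<Longrightarrow> rsmult M x (s \<otimes>\<^bsub>S\<^esub> s') = rsmult M (rsmult M x s) s'"
    and lsmult_rsmult_assoc:
      "\<lbrakk>r \<in> carrier R; x \<in> carrier M; s \<in> carrier S\<rbrakk>
        \<Longrightarrow> rsmult M (lsmult M r x) s = lsmult M r (rsmult M x s)"
    and lsmult_one: "x \<in> carrier M \<Longrightarrow> lsmult M \<one>\<^bsub>R\<^esub> x = x"
    and rsmult_one: "x \<in> carrier M \<Longrightarrow> rsmult M x \<one>\<^bsub>S\<^esub> = x"

definition bimodule_hom ::
  "('r, 'c) ring_scheme \<Rightarrow> ('s, 'd) ring_scheme \<Rightarrow> ('r, 's, 'm, 'e) bimodule_scheme
    \<Rightarrow> ('r, 's, 'k, 'f) bimodule_scheme \<Rightarrow> ('m \<Rightarrow> 'k) set"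
  where "bimodule_hom R S M N =
    {h \<in> hom (add_monoid M) (add_monoid N).
      (\<forall>r\<in>carrier R. \<forall>x\<in>carrier M. h (lsmult M r x) = lsmult N r (h x)) \<and>
      (\<forall>x\<in>carrier M. \<forall>s\<in>carrier S. h (rsmult M x s) = rsmult N (h x) s)}"

definition regular_bimodule :: "('a, 'c) ring_scheme \<Rightarrow> ('a, 'a, 'a) bimodule"
  where "regular_bimodule R =
    \<lparr>carrier = carrier R, monoid.mult = monoid.mult R, monoid.one = monoid.one R,
      ring.zero = ring.zero R, ring.add = ring.add R,
      lsmult = monoid.mult R, rsmult = monoid.mult R\<rparr>"

text \<open>The tensor product \<open>V \<otimes>\<^bsub>S\<^esub> W\<close> is the free abelian group on
  \<open>carrier V \<times> carrier W\<close> modulo the subgroup generated by the usual relations; its elements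
  are cosets of that subgroup.\<close>

definition tensor_relators ::
  "('r, 's, 'm) bimodule \<Rightarrow> ('s, 'c) ring_scheme \<Rightarrow> ('s, 't, 'k) bimodule
    \<Rightarrow> (('m \<times> 'k) \<Rightarrow>\<^sub>0 int) set"
  where "tensor_relators V S W =
    {frag_of (x \<oplus>\<^bsub>V\<^esub> x', y) - frag_of (x, y) - frag_of (x', y) | x x' y.
      x \<in> carrier V \<and> x' \<in> carrier V \<and> y \<in> carrier W} \<union>
    {frag_of (x, y \<oplus>\<^bsub>W\<^esub> y') - frag_of (x, y) - frag_of (x, y') | x y y'.
      x \<in> carrier V \<and> y \<in> carrier W \<and> y' \<in> carrier W} \<union>
    {frag_of (rsmult V x s, y) - frag_of (x, lsmult W s y) | x s y.
      x \<in> carrier V \<and> s \<in> carrier S \<and> y \<in> carrier W}"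

definition tensor_subgroup ::
  "('r, 's, 'm) bimodule \<Rightarrow> ('s, 'c) ring_scheme \<Rightarrow> ('s, 't, 'k) bimodule
    \<Rightarrow> (('m \<times> 'k) \<Rightarrow>\<^sub>0 int) set"
  where "tensor_subgroup V S W =
    generate (free_Abelian_group (carrier V \<times> carrier W)) (tensor_relators V S W)"

definition pure_tensor ::
  "('r, 's, 'm) bimodule \<Rightarrow> ('s, 'c) ring_scheme \<Rightarrow> ('s, 't, 'k) bimodule
    \<Rightarrow> 'm \<Rightarrow> 'k \<Rightarrow> (('m \<times> 'k) \<Rightarrow>\<^sub>0 int) set"
  where "pure_tensor V S W x y =
    tensor_subgroup V S W #>\<^bsub>free_Abelian_group (carrier V \<times> carrier W)\<^esub> frag_of (x, y)"

text \<open>The scalar actions are \<open>r (x \<otimes> y) = (r x) \<otimes> y\<close> and \<open>(x \<otimes> y) t = x \<otimes> (y t)\<close>, extended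
  additively: \<open>frag_extend\<close> gives the induced map on the free abelian group, and multiplying its
  image of a coset with the subgroup of relations gives the induced map on cosets.\<close>

definition tensor_product ::
  "('r, 's, 'm) bimodule \<Rightarrow> ('s, 'c) ring_scheme \<Rightarrow> ('s, 't, 'k) bimodule
    \<Rightarrow> ('r, 't, (('m \<times> 'k) \<Rightarrow>\<^sub>0 int) set) bimodule"
  where "tensor_product V S W =
    (let F = free_Abelian_group (carrier V \<times> carrier W);
         H = tensor_subgroup V S W
     in \<lparr>carrier = carrier (F Mod H), monoid.mult = undefined, monoid.one = undefined,
          ring.zero = \<one>\<^bsub>F Mod H\<^esub>, ring.add = monoid.mult (F Mod H),
          lsmult = (\<lambda>r U. H <#>\<^bsub>F\<^esub> (frag_extend (\<lambda>(x, y). frag_of (lsmult V r x, y)) ` U)),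
          rsmult = (\<lambda>U t. H <#>\<^bsub>F\<^esub> (frag_extend (\<lambda>(x, y). frag_of (x, rsmult W y t)) ` U))\<rparr>)"


section \<open>Generalized matrix rings\<close>

text \<open>\<open>D i\<close> are the diagonal rings and \<open>M i j\<close>, for \<open>i \<noteq> j\<close>, the off-diagonal
  bimodules, with indices in \<open>{1..n}\<close>; the values \<open>M i i\<close> are never used. All of these have
  carriers in a common type, which is no restriction: a family of sets embeds in one set.\<close>

definition gm_entry ::
  "(nat \<Rightarrow> 'a ring) \<Rightarrow> (nat \<Rightarrow> nat \<Rightarrow> ('a, 'a, 'a) bimodule) \<Rightarrow> nat \<Rightarrow> nat
    \<Rightarrow> ('a, 'a, 'a) bimodule"
  where "gm_entry D M i j = (if i = j then regular_bimodule (D i) else M i j)"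

type_synonym 'a gm_theta = "nat \<Rightarrow> nat \<Rightarrow> nat \<Rightarrow> (('a \<times> 'a) \<Rightarrow>\<^sub>0 int) set \<Rightarrow> 'a"

definition gm_prod ::
  "(nat \<Rightarrow> 'a ring) \<Rightarrow> (nat \<Rightarrow> nat \<Rightarrow> ('a, 'a, 'a) bimodule) \<Rightarrow> 'a gm_theta
    \<Rightarrow> nat \<Rightarrow> nat \<Rightarrow> nat \<Rightarrow> 'a \<Rightarrow> 'a \<Rightarrow> 'a"
  where "gm_prod D M \<theta> i j k x y =
    \<theta> i j k (pure_tensor (gm_entry D M i j) (D j) (gm_entry D M j k) x y)"

locale generalized_matrix_data =
  fixes n :: nat
    and D :: "nat \<Rightarrow> 'a ring"
    and M :: "nat \<Rightarrow> nat \<Rightarrow> ('a, 'a, 'a) bimodule"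
    and \<theta> :: "'a gm_theta"
  assumes diag_ring: "i \<in> {1..n} \<Longrightarrow> ring (D i)"
    and offdiag_bimodule:
      "\<lbrakk>i \<in> {1..n}; j \<in> {1..n}; i \<noteq> j\<rbrakk> \<Longrightarrow> bimodule (D i) (D j) (M i j)"
    and theta_hom:
      "\<lbrakk>i \<in> {1..n}; j \<in> {1..n}; k \<in> {1..n}\<rbrakk>
        \<Longrightarrow> \<theta> i j k \<in> bimodule_hom (D i) (D k)
              (tensor_product (gm_entry D M i j) (D j) (gm_entry D M j k)) (gm_entry D M i k)"
    and theta_diag:
      "\<lbrakk>i \<in> {1..n}; r \<in> carrier (D i); s \<in> carrier (D i)\<rbrakk>
        \<Longrightarrow> gm_prod D M \<theta> i i i r s = r \<otimes>\<^bsub>D i\<^esub> s"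
    and theta_lsmult:
      "\<lbrakk>i \<in> {1..n}; j \<in> {1..n}; i \<noteq> j; r \<in> carrier (D i); x \<in> carrier (M i j)\<rbrakk>
        \<Longrightarrow> gm_prod D M \<theta> i i j r x = lsmult (M i j) r x"
    and theta_rsmult:
      "\<lbrakk>i \<in> {1..n}; j \<in> {1..n}; i \<noteq> j; x \<in> carrier (M i j); s \<in> carrier (D j)\<rbrakk>
        \<Longrightarrow> gm_prod D M \<theta> i j j x s = rsmult (M i j) x s"
    and theta_assoc:
      "\<lbrakk>i \<in> {1..n}; j \<in> {1..n}; k \<in> {1..n}; l \<in> {1..n};
        x \<in> carrier (gm_entry D M i j); y \<in> carrier (gm_entry D M j k);
        z \<in> carrier (gm_entry D M k l)\<rbrakk>
        \<Longrightarrow> gm_prod D M \<theta> i k l (gm_prod D M \<theta> i j k x y) z =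
            gm_prod D M \<theta> i j l x (gm_prod D M \<theta> j k l y z)"

text \<open>A matrix is a function on index pairs that is \<open>undefined\<close> outside
  \<open>{1..n} \<times> {1..n}\<close>.\<close>

definition gm_ring ::
  "nat \<Rightarrow> (nat \<Rightarrow> 'a ring) \<Rightarrow> (nat \<Rightarrow> nat \<Rightarrow> ('a, 'a, 'a) bimodule) \<Rightarrow> 'a gm_theta
    \<Rightarrow> (nat \<times> nat \<Rightarrow> 'a) ring"
  where "gm_ring n D M \<theta> =
    \<lparr>carrier = (\<Pi>\<^sub>E (i, j) \<in> {1..n} \<times> {1..n}. carrier (gm_entry D M i j)),
      monoid.mult = (\<lambda>a b. \<lambda>(i, k) \<in> {1..n} \<times> {1..n}.
        \<Oplus>\<^bsub>gm_entry D M i k\<^esub> j \<in> {1..n}. gm_prod D M \<theta> i j k (a (i, j)) (b (j, k))),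
      monoid.one = (\<lambda>(i, j) \<in> {1..n} \<times> {1..n}. if i = j then \<one>\<^bsub>D i\<^esub> else \<zero>\<^bsub>M i j\<^esub>),
      ring.zero = (\<lambda>(i, j) \<in> {1..n} \<times> {1..n}. \<zero>\<^bsub>gm_entry D M i j\<^esub>),
      ring.add = (\<lambda>a b. \<lambda>(i, j) \<in> {1..n} \<times> {1..n}. a (i, j) \<oplus>\<^bsub>gm_entry D M i j\<^esub> b (i, j))\<rparr>"

locale class_T = generalized_matrix_data +
  assumes n_gt_1: "n > 1"
    and theta_iji_zero:
      "\<lbrakk>i \<in> {1..n}; j \<in> {1..n}; i \<noteq> j;
        u \<in> carrier (tensor_product (gm_entry D M i j) (D j) (gm_entry D M j i))\<rbrakk>
        \<Longrightarrow> \<theta> i j i u = \<zero>\<^bsub>D i\<^esub>"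

definition gm_diag ::
  "nat \<Rightarrow> (nat \<Rightarrow> 'a ring) \<Rightarrow> (nat \<Rightarrow> nat \<Rightarrow> ('a, 'a, 'a) bimodule) \<Rightarrow> 'a gm_theta
    \<Rightarrow> (nat \<times> nat \<Rightarrow> 'a) set"
  where "gm_diag n D M \<theta> =
    {t \<in> carrier (gm_ring n D M \<theta>).
      \<forall>i\<in>{1..n}. \<forall>j\<in>{1..n}. i \<noteq> j \<longrightarrow> t (i, j) = \<zero>\<^bsub>M i j\<^esub>}"

definition gm_E ::
  "nat \<Rightarrow> (nat \<Rightarrow> 'a ring) \<Rightarrow> (nat \<Rightarrow> nat \<Rightarrow> ('a, 'a, 'a) bimodule) \<Rightarrow> 'a gm_theta
    \<Rightarrow> nat \<Rightarrow> (nat \<times> nat \<Rightarrow> 'a) set"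
  where "gm_E n D M \<theta> k =
    {t \<in> carrier (gm_ring n D M \<theta>).
      t (k, k) = \<one>\<^bsub>D k\<^esub> \<and>
      (\<forall>i\<in>{1..n}. \<forall>j\<in>{1..n}. i \<noteq> k \<longrightarrow> t (i, j) = \<zero>\<^bsub>gm_entry D M i j\<^esub>)}"


section \<open>Prime ideals and prime factors\<close>

text \<open>The library's \<open>primeideal\<close> is for commutative rings.\<close>

definition nc_prime_ideal :: "'a set \<Rightarrow> ('a, 'c) ring_scheme \<Rightarrow> bool"
  where "nc_prime_ideal P A \<longleftrightarrow>
    ideal P A \<and> P \<noteq> carrier A \<and>
    (\<forall>I J. ideal I A \<and> ideal J A \<and> ideal_prod A I J \<subseteq> P \<longrightarrow> I \<subseteq> P \<or> J \<subseteq> P)"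

text \<open>A property of rings is a predicate on the rings over a type \<open>'u\<close>. The factor ring
  \<open>A Quot P\<close> has elements of type \<open>'u set\<close>, but it always has an isomorphic copy over \<open>'u\<close>
  itself (choose coset representatives), so its having the property means that such a copy
  does.\<close>

definition copy_has :: "('u ring \<Rightarrow> bool) \<Rightarrow> 'b ring \<Rightarrow> bool"
  where "copy_has C A \<longleftrightarrow> (\<exists>B. ring B \<and> A \<simeq> B \<and> C B)"

definition isomorphism_invariant :: "('u ring \<Rightarrow> bool) \<Rightarrow> bool"
  where "isomorphism_invariant C \<longleftrightarrow> (\<forall>A B. ring A \<and> ring B \<and> A \<simeq> B \<and> C A \<longrightarrow> C B)"

definition determined_by_prime_factors :: "('u ring \<Rightarrow> bool) \<Rightarrow> bool"
  where "determined_by_prime_factors C \<longleftrightarrow>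
    (\<forall>A. ring A \<longrightarrow> (C A \<longleftrightarrow> (\<forall>P. nc_prime_ideal P A \<longrightarrow> copy_has C (A Quot P))))"

text \<open>Finite chains \<open>P 0 \<subset> \<dots> \<subset> P m\<close> have length \<open>m\<close>; the zero ring has dimension \<open>-\<infinity>\<close>.\<close>

definition classical_Krull_dim :: "('a, 'c) ring_scheme \<Rightarrow> ereal"
  where "classical_Krull_dim A =
    (SUP m \<in> {m :: nat. \<exists>P. (\<forall>i\<le>m. nc_prime_ideal (P i) A) \<and> (\<forall>i<m. P i \<subset> P (Suc i))}.
      ereal (real m))"


section \<open>Special radicals\<close>

text \<open>Rings not necessarily with unity: the field \<open>one\<close> of the record is ignored.\<close>

locale nonunital_ring = abelian_group A for A (structure) +
  assumes m_closed: "\<lbrakk>x \<in> carrier A; y \<in> carrier A\<rbrakk> \<Longrightarrow> x \<otimes> y \<in> carrier A"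
    and m_assoc: "\<lbrakk>x \<in> carrier A; y \<in> carrier A; z \<in> carrier A\<rbrakk>
      \<Longrightarrow> (x \<otimes> y) \<otimes> z = x \<otimes> (y \<otimes> z)"
    and l_distr: "\<lbrakk>x \<in> carrier A; y \<in> carrier A; z \<in> carrier A\<rbrakk>
      \<Longrightarrow> (x \<oplus> y) \<otimes> z = x \<otimes> z \<oplus> y \<otimes> z"
    and r_distr: "\<lbrakk>x \<in> carrier A; y \<in> carrier A; z \<in> carrier A\<rbrakk>
      \<Longrightarrow> z \<otimes> (x \<oplus> y) = z \<otimes> x \<oplus> z \<otimes> y"

definition nu_ideal :: "'a set \<Rightarrow> ('a, 'c) ring_scheme \<Rightarrow> bool"
  where "nu_ideal I A \<longleftrightarrow>
    additive_subgroup I A \<and>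
    (\<forall>a\<in>I. \<forall>x\<in>carrier A. x \<otimes>\<^bsub>A\<^esub> a \<in> I \<and> a \<otimes>\<^bsub>A\<^esub> x \<in> I)"

definition nu_iso :: "('a, 'c) ring_scheme \<Rightarrow> ('b, 'd) ring_scheme \<Rightarrow> bool"
  where "nu_iso A B \<longleftrightarrow>
    (\<exists>h. h \<in> iso (add_monoid A) (add_monoid B) \<and> h \<in> hom A B)"

definition nu_prime :: "('a, 'c) ring_scheme \<Rightarrow> bool"
  where "nu_prime A \<longleftrightarrow>
    (\<forall>I J. nu_ideal I A \<and> nu_ideal J A \<and> ideal_prod A I J = {\<zero>\<^bsub>A\<^esub>}
      \<longrightarrow> I = {\<zero>\<^bsub>A\<^esub>} \<or> J = {\<zero>\<^bsub>A\<^esub>})"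

definition essential_ideal :: "'a set \<Rightarrow> ('a, 'c) ring_scheme \<Rightarrow> bool"
  where "essential_ideal I A \<longleftrightarrow>
    nu_ideal I A \<and> (\<forall>J. nu_ideal J A \<and> J \<noteq> {\<zero>\<^bsub>A\<^esub>} \<longrightarrow> I \<inter> J \<noteq> {\<zero>\<^bsub>A\<^esub>})"

text \<open>Whether the zero ring counts as prime varies in the literature, and has no influence on
  the radical. Here a special class may or may not contain it: \<open>nu_prime\<close> admits it, and
  closure is only required for nonzero ideals.\<close>

definition special_class :: "'u ring set \<Rightarrow> bool"
  where "special_class \<M> \<longleftrightarrow>
    (\<forall>A\<in>\<M>. nonunital_ring A \<and> nu_prime A) \<and>
    (\<forall>A B. A \<in> \<M> \<and> nonunital_ring B \<and> nu_iso A B \<longrightarrow> B \<in> \<M>) \<and>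
    (\<forall>A I. A \<in> \<M> \<and> nu_ideal I A \<and> I \<noteq> {\<zero>\<^bsub>A\<^esub>} \<longrightarrow> A\<lparr>carrier := I\<rparr> \<in> \<M>) \<and>
    (\<forall>A I. nonunital_ring A \<and> essential_ideal I A \<and> A\<lparr>carrier := I\<rparr> \<in> \<M> \<longrightarrow> A \<in> \<M>)"

text \<open>Membership of \<open>A Quot I\<close> in the class is again understood up to isomorphism, as its
  elements need not have type \<open>'u\<close>.\<close>

definition special_radical :: "'u ring set \<Rightarrow> ('a, 'c) ring_scheme \<Rightarrow> 'a set"
  where "special_radical \<M> A =
    carrier A \<inter> \<Inter>{I. nu_ideal I A \<and> (\<exists>B\<in>\<M>. nu_iso (A Quot I) B)}"

end

theory Submission
  imports Defs
begin

text \<open>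
  Let \<open>f\<close> be the map that keeps the diagonal of a matrix and replaces all other entries by
  zero. The entry of a product \<open>s t\<close> at \<open>(i, i)\<close> is the sum over \<open>j\<close> of \<open>s\<^sub>i\<^sub>j t\<^sub>j\<^sub>i\<close>, and
  because \<open>\<theta>\<^sub>i\<^sub>j\<^sub>i = 0\<close> for \<open>j \<noteq> i\<close> only \<open>s\<^sub>i\<^sub>i t\<^sub>i\<^sub>i\<close> survives. So \<open>f\<close> is a ring
  homomorphism from \<open>T\<close> onto \<open>R\<close> that fixes \<open>R\<close> (\<open>diag_mult\<close>), and its kernel \<open>N\<close> consists of
  the matrices with zero diagonal.

  Every prime ideal of \<open>T\<close> contains \<open>N\<close>. It suffices to see this for a matrix \<open>x\<close> with a single
  nonzero entry \<open>m\<close>, at an off-diagonal position \<open>(i, j)\<close>, since these add up to \<open>N\<close>. For any \<open>t\<close>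
  the only entry of \<open>x t x\<close> that could be nonzero is \<open>(m t\<^sub>j\<^sub>i) m\<close>, and \<open>m t\<^sub>j\<^sub>i\<close> is a value of
  \<open>\<theta>\<^sub>i\<^sub>j\<^sub>i\<close>. Hence \<open>x T x = 0\<close> (\<open>single_mult_single\<close>), and an element with this property lies in
  every prime ideal (\<open>prime_or_unit_ideal_mem\<close>). The same argument applies to every ideal \<open>I\<close> for
  which \<open>T/I\<close> belongs to a special class, because such factors are prime (\<open>nu_prime_factor\<close>).

  So preimages under \<open>f\<close> give an inclusion-preserving bijection from the prime ideals of \<open>R\<close> to
  those of \<open>T\<close>, with isomorphic factors. The claims on ring properties, special radicals and Krull
  dimension depend only on this correspondence, and are derived for any surjection whose kernel
  lies in all primes, in the locale \<open>prime_reflecting_hom\<close>; for the radicals one uses in addition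
  that \<open>f\<close> fixes \<open>R\<close>.

  The set \<open>R \<union> \<E>\<close> generates \<open>T\<close> because a matrix whose only nonzero entry is at \<open>(k, j)\<close>, with \<open>j \<noteq> k\<close>, is the
  difference of an element of \<open>\<E>\<^sub>k\<close> and the diagonal idempotent \<open>e\<^sub>k\<^sub>k\<close> (\<open>generate_ring_diag_E\<close>).

  These arguments need \<open>T\<close> to be a ring. The product maps are given as homomorphisms on
  tensor products, and the ring axioms follow from their associativity once the products of
  entries are known to be biadditive (\<open>pure_tensor_add_eq\<close>).
\<close>

section \<open>Prime ideals and prime factors of noncommutative rings\<close>

text \<open>A special class may contain the zero ring, so the ideals that define its radical are prime
  or the whole ring. Most of what is needed about prime ideals holds for both.\<close>
definition prime_or_unit_ideal :: "'a set \<Rightarrow> ('a, 'c) ring_scheme \<Rightarrow> bool"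
  where "prime_or_unit_ideal P A \<longleftrightarrow> ideal P A \<and>
    (\<forall>I J. ideal I A \<and> ideal J A \<and> ideal_prod A I J \<subseteq> P \<longrightarrow> I \<subseteq> P \<or> J \<subseteq> P)"

lemma nc_prime_ideal_iff:
  "nc_prime_ideal P A \<longleftrightarrow> prime_or_unit_ideal P A \<and> P \<noteq> carrier A"
  by (auto simp: nc_prime_ideal_def prime_or_unit_ideal_def)

lemma ideal_prod_subsetI:
  assumes "ideal P A" "\<And>i j. \<lbrakk>i \<in> I; j \<in> J\<rbrakk> \<Longrightarrow> i \<otimes>\<^bsub>A\<^esub> j \<in> P"
  shows "ideal_prod A I J \<subseteq> P"
proof
  interpret ideal P A by fact
  fix x assume "x \<in> ideal_prod A I J"
  then show "x \<in> P"
    by induction (auto intro: assms(2))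
qed

text \<open>Closure under negation comes from multiplication by \<open>-1\<close>.\<close>
lemma idealI_closed:
  assumes "ring A"
    and sub: "\<And>a. a \<in> I \<Longrightarrow> a \<in> carrier A" and zero: "\<zero>\<^bsub>A\<^esub> \<in> I"
    and add: "\<And>a b. \<lbrakk>a \<in> I; b \<in> I\<rbrakk> \<Longrightarrow> a \<oplus>\<^bsub>A\<^esub> b \<in> I"
    and l: "\<And>a x. \<lbrakk>a \<in> I; x \<in> carrier A\<rbrakk> \<Longrightarrow> x \<otimes>\<^bsub>A\<^esub> a \<in> I"
    and r: "\<And>a x. \<lbrakk>a \<in> I; x \<in> carrier A\<rbrakk> \<Longrightarrow> a \<otimes>\<^bsub>A\<^esub> x \<in> I"
  shows "ideal I A"
proof -
  interpret ring A by fact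
  have "\<ominus>\<^bsub>A\<^esub> a \<in> I" if "a \<in> I" for a
    using l[OF that, of "\<ominus>\<^bsub>A\<^esub> \<one>\<^bsub>A\<^esub>"] sub[OF that] by (simp add: l_minus)
  then have "subgroup I (add_monoid A)"
    using sub zero add by (intro add.subgroupI) (auto simp: a_inv_def)
  then show ?thesis using l r by (intro idealI ring_axioms)
qed

lemma zero_Quot: "\<zero>\<^bsub>A Quot I\<^esub> = I"
  by (simp add: FactRing_def)

lemma rcos_surj: "(+>\<^bsub>A\<^esub>) I ` carrier A = carrier (A Quot I)"
  unfolding FactRing_def A_RCOSETS_def' by (simp add: UNION_singleton_eq_range)

lemma nc_prime_ideal_imp_ideal: "nc_prime_ideal P A \<Longrightarrow> ideal P A"
  by (simp add: nc_prime_ideal_def)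

text \<open>The elementwise form of primeness. Two ideals with product in \<open>P\<close> that both contain \<open>x\<close> are
  obtained as annihilators modulo \<open>P\<close>: first \<open>L\<close>, the elements \<open>y\<close> with \<open>y A x \<subseteq> P\<close>, and then
  \<open>K\<close>, the elements \<open>z\<close> with \<open>L A z \<subseteq> P\<close>. This avoids a description of the ideal generated
  by \<open>x\<close>.\<close>
lemma prime_or_unit_ideal_mem:
  assumes P: "prime_or_unit_ideal P A" and x: "x \<in> carrier A"
    and xtx: "\<And>t. t \<in> carrier A \<Longrightarrow> (x \<otimes>\<^bsub>A\<^esub> t) \<otimes>\<^bsub>A\<^esub> x \<in> P"
  shows "x \<in> P"
proof -
  have P': "ideal P A" using P by (simp add: prime_or_unit_ideal_def)
  interpret ideal P A by fact
  define L where "L = {y \<in> carrier A. \<forall>t\<in>carrier A. (y \<otimes>\<^bsub>A\<^esub> t) \<otimes>\<^bsub>A\<^esub> x \<in> P}"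
  define K where "K = {z \<in> carrier A. \<forall>y\<in>L. \<forall>t\<in>carrier A. (y \<otimes>\<^bsub>A\<^esub> t) \<otimes>\<^bsub>A\<^esub> z \<in> P}"
  have Lc: "y \<in> carrier A" if "y \<in> L" for y using that by (simp add: L_def)
  have L: "ideal L A"
  proof (rule idealI_closed[OF ring_axioms])
    show "\<zero>\<^bsub>A\<^esub> \<in> L" using x by (simp add: L_def)
    show "a \<oplus>\<^bsub>A\<^esub> b \<in> L" if "a \<in> L" "b \<in> L" for a b
      using that x by (simp add: L_def l_distr)
    show "y \<otimes>\<^bsub>A\<^esub> a \<in> L" if a: "a \<in> L" "y \<in> carrier A" for a y
    proof -
      have "y \<otimes>\<^bsub>A\<^esub> ((a \<otimes>\<^bsub>A\<^esub> t) \<otimes>\<^bsub>A\<^esub> x) \<in> P" if "t \<in> carrier A" for t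
        using that a by (simp add: L_def I_l_closed)
      then show ?thesis using a x by (simp add: L_def m_assoc)
    qed
    show "a \<otimes>\<^bsub>A\<^esub> y \<in> L" if a: "a \<in> L" "y \<in> carrier A" for a y
    proof -
      have "(a \<otimes>\<^bsub>A\<^esub> (y \<otimes>\<^bsub>A\<^esub> t)) \<otimes>\<^bsub>A\<^esub> x \<in> P" if "t \<in> carrier A" for t
        using that a by (simp add: L_def)
      then show ?thesis using a x by (simp add: L_def m_assoc)
    qed
  qed (rule Lc)
  have K: "ideal K A"
  proof (rule idealI_closed[OF ring_axioms])
    show "z \<in> carrier A" if "z \<in> K" for z using that by (simp add: K_def)
    show "\<zero>\<^bsub>A\<^esub> \<in> K" using Lc by (simp add: K_def)
    show "a \<oplus>\<^bsub>A\<^esub> b \<in> K" if "a \<in> K" "b \<in> K" for a b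
      using that Lc by (simp add: K_def r_distr)
    show "y \<otimes>\<^bsub>A\<^esub> a \<in> K" if a: "a \<in> K" "y \<in> carrier A" for a y
    proof -
      have "(l \<otimes>\<^bsub>A\<^esub> t) \<otimes>\<^bsub>A\<^esub> (y \<otimes>\<^bsub>A\<^esub> a) \<in> P" if "l \<in> L" "t \<in> carrier A" for l t
      proof -
        have "(l \<otimes>\<^bsub>A\<^esub> (t \<otimes>\<^bsub>A\<^esub> y)) \<otimes>\<^bsub>A\<^esub> a \<in> P" using that a by (simp add: K_def)
        then show ?thesis using that a Lc by (simp add: K_def m_assoc)
      qed
      then show ?thesis using a by (simp add: K_def)
    qed
    show "a \<otimes>\<^bsub>A\<^esub> y \<in> K" if a: "a \<in> K" "y \<in> carrier A" for a y
    proof -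
      have "(l \<otimes>\<^bsub>A\<^esub> t) \<otimes>\<^bsub>A\<^esub> (a \<otimes>\<^bsub>A\<^esub> y) \<in> P" if "l \<in> L" "t \<in> carrier A" for l t
      proof -
        have "((l \<otimes>\<^bsub>A\<^esub> t) \<otimes>\<^bsub>A\<^esub> a) \<otimes>\<^bsub>A\<^esub> y \<in> P" using that a by (simp add: K_def I_r_closed)
        then show ?thesis using that a Lc by (simp add: K_def m_assoc)
      qed
      then show ?thesis using a by (simp add: K_def)
    qed
  qed
  have "ideal_prod A L K \<subseteq> P"
  proof (rule ideal_prod_subsetI[OF P'])
    fix l k assume lk: "l \<in> L" "k \<in> K"
    then have "(l \<otimes>\<^bsub>A\<^esub> \<one>\<^bsub>A\<^esub>) \<otimes>\<^bsub>A\<^esub> k \<in> P" unfolding K_def by blast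
    then show "l \<otimes>\<^bsub>A\<^esub> k \<in> P" using lk Lc by simp
  qed
  then have "L \<subseteq> P \<or> K \<subseteq> P" using P L K by (auto simp: prime_or_unit_ideal_def)
  moreover have "x \<in> L" using x xtx by (simp add: L_def)
  moreover have "x \<in> K" using x by (simp add: K_def L_def)
  ultimately show ?thesis by blast
qed

lemma nu_ideal_iff_ideal:
  assumes "ring A"
  shows "nu_ideal I A \<longleftrightarrow> ideal I A"
  using assms by (auto simp: nu_ideal_def ideal_def ideal_axioms_def)

lemma nu_ideal_image:
  assumes h: "h \<in> hom (add_monoid A) (add_monoid B)" "h \<in> hom A B"
    and surj: "h ` carrier A = carrier B"
    and A: "ring A" and B: "nonunital_ring B" and I: "ideal I A"
  shows "nu_ideal (h ` I) B"
proof -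
  interpret A: ideal I A by fact
  interpret B: nonunital_ring B by fact
  interpret h: abelian_group_hom A B h
    using h(1) by (intro abelian_group_homI group_hom.intro group_hom_axioms.intro
      A.add.is_group B.add.is_group A.abelian_group_axioms B.abelian_group_axioms)
  have "subgroup (h ` I) (add_monoid B)"
    using group_hom.subgroup_img_is_subgroup[OF h.a_group_hom A.additive_subgroup_axioms[unfolded additive_subgroup_def]] .
  moreover have "x \<otimes>\<^bsub>B\<^esub> h a \<in> h ` I \<and> h a \<otimes>\<^bsub>B\<^esub> x \<in> h ` I" if "a \<in> I" "x \<in> carrier B" for a x
  proof -
    have "x \<in> h ` carrier A" using that by (simp add: surj)
    then obtain y where y: "y \<in> carrier A" "x = h y" by blast
    have "x \<otimes>\<^bsub>B\<^esub> h a = h (y \<otimes>\<^bsub>A\<^esub> a)" "h a \<otimes>\<^bsub>B\<^esub> x = h (a \<otimes>\<^bsub>A\<^esub> y)"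
      using y that hom_mult[OF h(2)] by auto
    then show ?thesis using y that A.I_l_closed A.I_r_closed by simp
  qed
  ultimately show ?thesis by (auto simp: nu_ideal_def additive_subgroup_def)
qed

text \<open>The images in \<open>B\<close> of two ideals of \<open>A\<close> with product in \<open>I\<close> have product zero, so one of the
  images is zero, which means that this ideal is contained in the kernel \<open>I\<close> of \<open>A \<rightarrow> B\<close>.\<close>
lemma nu_prime_factor:
  assumes A: "ring A" and I: "nu_ideal I A" and iso: "nu_iso (A Quot I) B"
    and B: "nonunital_ring B" "nu_prime B"
  shows "prime_or_unit_ideal I A"
proof -
  have I': "ideal I A" using A I by (simp add: nu_ideal_iff_ideal)
  interpret I: ideal I A by fact
  interpret q: ring_hom_ring A "A Quot I" "(+>\<^bsub>A\<^esub>) I" by (rule I.rcos_ring_hom_ring)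
  interpret B: nonunital_ring B by fact
  from iso obtain h where h: "h \<in> iso (add_monoid (A Quot I)) (add_monoid B)" "h \<in> hom (A Quot I) B"
    by (auto simp: nu_iso_def)
  define g where "g = h \<circ> (+>\<^bsub>A\<^esub>) I"
  have hsurj: "h ` carrier (A Quot I) = carrier B"
    using h(1) by (simp add: iso_def bij_betw_def)
  have gsurj: "g ` carrier A = carrier B"
    unfolding g_def image_comp[symmetric] rcos_surj hsurj ..
  have gadd: "g \<in> hom (add_monoid A) (add_monoid B)"
    unfolding g_def using h(1) by (intro hom_compose[OF q.a_group_hom[THEN group_hom.homh]]) (simp add: iso_def)
  have gmult: "g \<in> hom A B"
    unfolding g_def
    by (intro hom_compose[OF _ h(2)]) (auto simp: hom_def)
  interpret g: abelian_group_hom A B g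
    using gadd by (intro abelian_group_homI group_hom.intro group_hom_axioms.intro
      I.add.is_group B.add.is_group I.abelian_group_axioms B.abelian_group_axioms)
  have ker: "x \<in> I" if x: "x \<in> carrier A" "g x = \<zero>\<^bsub>B\<^esub>" for x
  proof -
    have "h (I +>\<^bsub>A\<^esub> x) = h \<zero>\<^bsub>A Quot I\<^esub>"
      using x g.hom_zero by (simp add: g_def)
    moreover have "inj_on h (carrier (A Quot I))" using h(1) by (simp add: iso_def bij_betw_def)
    ultimately have "I +>\<^bsub>A\<^esub> x = \<zero>\<^bsub>A Quot I\<^esub>"
      using x by (meson inj_onD q.hom_closed q.S.zero_closed)
    then have "I +>\<^bsub>A\<^esub> x = I" by (simp only: zero_Quot)
    then show ?thesis by (rule I.rcos_const_imp_mem[OF x(1)])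
  qed
  have zero: "g x = \<zero>\<^bsub>B\<^esub>" if "x \<in> I" for x
  proof -
    have "I +>\<^bsub>A\<^esub> x = \<zero>\<^bsub>A Quot I\<^esub>" using I.a_rcos_const[OF that] by (simp only: zero_Quot)
    then have "g x = g \<zero>\<^bsub>A\<^esub>" using q.hom_zero by (simp add: g_def)
    then show ?thesis using g.hom_zero by simp
  qed
  show ?thesis unfolding prime_or_unit_ideal_def
  proof (intro conjI allI impI I')
    fix J K assume JK: "ideal J A \<and> ideal K A \<and> ideal_prod A J K \<subseteq> I"
    then interpret J: ideal J A + K: ideal K A by auto
    have nu: "nu_ideal (g ` J) B" "nu_ideal (g ` K) B"
      using JK by (auto intro: nu_ideal_image[OF gadd gmult gsurj A B(1)])
    have all_zero: "y = \<zero>\<^bsub>B\<^esub>" if "y \<in> ideal_prod B (g ` J) (g ` K)" for y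
      using that
    proof induction
      case (prod i j)
      then obtain a b where ab: "a \<in> J" "b \<in> K" "i = g a" "j = g b" by blast
      then have "i \<otimes>\<^bsub>B\<^esub> j = g (a \<otimes>\<^bsub>A\<^esub> b)" using hom_mult[OF gmult] by simp
      moreover have "a \<otimes>\<^bsub>A\<^esub> b \<in> I" using ab JK by (blast intro: ideal_prod.prod)
      ultimately show ?case using zero by simp
    qed simp
    have nonempty: "g \<zero>\<^bsub>A\<^esub> \<otimes>\<^bsub>B\<^esub> g \<zero>\<^bsub>A\<^esub> \<in> ideal_prod B (g ` J) (g ` K)"
      by (intro ideal_prod.prod imageI J.zero_closed K.zero_closed)
    have "ideal_prod B (g ` J) (g ` K) = {\<zero>\<^bsub>B\<^esub>}"
      using nonempty unfolding all_zero[OF nonempty] by (auto dest: all_zero)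
    then have "g ` J = {\<zero>\<^bsub>B\<^esub>} \<or> g ` K = {\<zero>\<^bsub>B\<^esub>}"
      using nu B(2) by (simp add: nu_prime_def)
    then have "(\<forall>x\<in>J. g x = \<zero>\<^bsub>B\<^esub>) \<or> (\<forall>x\<in>K. g x = \<zero>\<^bsub>B\<^esub>)"
      by (metis image_eqI singletonD)
    then show "J \<subseteq> I \<or> K \<subseteq> I"
      using ker J.Icarr K.Icarr by (meson subsetI)
  qed
qed

lemma nu_iso_trans: "nu_iso A B \<Longrightarrow> nu_iso B C \<Longrightarrow> nu_iso A C"
  unfolding nu_iso_def by (meson hom_compose iso_set_trans)

lemma ring_iso_imp_nu_iso:
  assumes "A \<simeq> B" shows "nu_iso A B"
proof -
  obtain h where "h \<in> ring_iso A B" using assms by (auto simp: is_ring_iso_def)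
  then show ?thesis
    by (auto simp: nu_iso_def ring_iso_def ring_hom_def iso_def hom_def)
qed

lemma copy_has_cong:
  assumes "ring A" "A \<simeq> B"
  shows "copy_has C A \<longleftrightarrow> copy_has C B"
  unfolding copy_has_def using assms ring_iso_sym ring_iso_trans by metis

section \<open>Surjections whose kernel lies in every prime ideal\<close>

text \<open>The situation of a quotient by an ideal contained in the prime radical. The condition on the
  kernel also mentions the unit ideal, for which it is trivial, so that it covers at once the
  prime ideals and the ideals whose factor lies in a special class.\<close>

locale prime_reflecting_hom = ring_hom_ring T R f
  for T :: "('a, 'c) ring_scheme" and R :: "('b, 'd) ring_scheme" and f +
  assumes surj: "f ` carrier T = carrier R"
    and kernel_in_primes: "prime_or_unit_ideal P T \<Longrightarrow> a_kernel T R f \<subseteq> P"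
begin

definition preimage :: "'b set \<Rightarrow> 'a set"
  where "preimage Q = {x \<in> carrier T. f x \<in> Q}"

lemma preimage_carrier: "preimage (carrier R) = carrier T"
  by (auto simp: preimage_def)

lemma image_preimage: "Q \<subseteq> carrier R \<Longrightarrow> f ` preimage Q = Q"
  using surj by (auto simp: preimage_def image_iff subset_iff) 

lemma preimage_subset_iff:
  assumes "Q \<subseteq> carrier R" shows "preimage Q \<subseteq> preimage Q' \<longleftrightarrow> Q \<subseteq> Q'"
  using image_preimage[OF assms] image_mono[of "preimage Q" "preimage Q'" f] by (auto simp: preimage_def)

lemma ideal_preimage: "ideal Q R \<Longrightarrow> ideal (preimage Q) T"
  unfolding preimage_def by (rule ideal_vimage)

lemma ideal_image:
  assumes "ideal I T" shows "ideal (f ` I) R"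
proof -
  have "f \<in> hom (add_monoid T) (add_monoid R)" "f \<in> hom T R"
    using homh by (auto simp: ring_hom_def hom_def)
  moreover have "nonunital_ring R"
    by (intro nonunital_ring.intro nonunital_ring_axioms.intro S.abelian_group_axioms)
      (auto simp: S.m_assoc S.l_distr S.r_distr)
  ultimately have "nu_ideal (f ` I) R"
    using nu_ideal_image surj R.ring_axioms assms by blast
  then show ?thesis by (simp add: nu_ideal_iff_ideal S.ring_axioms)
qed

text \<open>Surjectivity makes images of ideals ideals again, so that products of ideals can be compared
  in both directions.\<close>
lemma prime_or_unit_preimage_iff:
  assumes Q: "ideal Q R"
  shows "prime_or_unit_ideal (preimage Q) T \<longleftrightarrow> prime_or_unit_ideal Q R"
proof
  assume p: "prime_or_unit_ideal (preimage Q) T"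
  show "prime_or_unit_ideal Q R" unfolding prime_or_unit_ideal_def
  proof (intro conjI allI impI Q)
    fix I J assume IJ: "ideal I R \<and> ideal J R \<and> ideal_prod R I J \<subseteq> Q"
    then interpret I: ideal I R + J: ideal J R by auto
    have "ideal_prod T (preimage I) (preimage J) \<subseteq> preimage Q"
    proof (rule ideal_prod_subsetI[OF ideal_preimage[OF Q]])
      fix i j assume "i \<in> preimage I" "j \<in> preimage J"
      then show "i \<otimes>\<^bsub>T\<^esub> j \<in> preimage Q"
        using IJ ideal_prod.prod[of "f i" I "f j" J R] by (auto simp: preimage_def)
    qed
    then have "preimage I \<subseteq> preimage Q \<or> preimage J \<subseteq> preimage Q"
      using p IJ ideal_preimage unfolding prime_or_unit_ideal_def by blast
    then show "I \<subseteq> Q \<or> J \<subseteq> Q"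
      using preimage_subset_iff I.a_subset J.a_subset by blast
  qed
next
  assume p: "prime_or_unit_ideal Q R"
  show "prime_or_unit_ideal (preimage Q) T" unfolding prime_or_unit_ideal_def
  proof (intro conjI allI impI ideal_preimage[OF Q])
    fix I J assume IJ: "ideal I T \<and> ideal J T \<and> ideal_prod T I J \<subseteq> preimage Q"
    then interpret I: ideal I T + J: ideal J T by auto
    have "ideal_prod R (f ` I) (f ` J) \<subseteq> Q"
    proof (rule ideal_prod_subsetI[OF Q])
      fix i j assume "i \<in> f ` I" "j \<in> f ` J"
      then obtain a b where ab: "a \<in> I" "b \<in> J" "i = f a" "j = f b" by blast
      then have "a \<otimes>\<^bsub>T\<^esub> b \<in> preimage Q" using IJ by (blast intro: ideal_prod.prod)
      then show "i \<otimes>\<^bsub>R\<^esub> j \<in> Q" using ab by (simp add: preimage_def)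
    qed
    then have "f ` I \<subseteq> Q \<or> f ` J \<subseteq> Q"
      using p IJ ideal_image unfolding prime_or_unit_ideal_def by blast
    then show "I \<subseteq> preimage Q \<or> J \<subseteq> preimage Q"
      using I.Icarr J.Icarr by (auto simp: preimage_def)
  qed
qed

text \<open>Elements with the same value under \<open>f\<close> differ by an element of the kernel, hence of \<open>P\<close>.\<close>
lemma preimage_image_prime:
  assumes P: "prime_or_unit_ideal P T"
  shows "preimage (f ` P) = P"
proof -
  interpret P: ideal P T using P by (simp add: prime_or_unit_ideal_def)
  have "x \<in> P" if x: "x \<in> carrier T" "y \<in> P" "f x = f y" for x y
  proof -
    have y: "y \<in> carrier T" using x(2) by (rule P.Icarr)
    have "f (x \<oplus>\<^bsub>T\<^esub> \<ominus>\<^bsub>T\<^esub> y) = f y \<oplus>\<^bsub>R\<^esub> \<ominus>\<^bsub>R\<^esub> f y"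
      using x(1,3) y by simp
    also have "\<dots> = \<zero>\<^bsub>R\<^esub>" using y by (intro S.r_neg) simp
    finally have "f (x \<oplus>\<^bsub>T\<^esub> \<ominus>\<^bsub>T\<^esub> y) = \<zero>\<^bsub>R\<^esub>" .
    then have "x \<oplus>\<^bsub>T\<^esub> \<ominus>\<^bsub>T\<^esub> y \<in> a_kernel T R f"
      using x(1) y unfolding a_kernel_def' by simp
    then have "x \<oplus>\<^bsub>T\<^esub> \<ominus>\<^bsub>T\<^esub> y \<in> P" using kernel_in_primes[OF P] by blast
    then have "(x \<oplus>\<^bsub>T\<^esub> \<ominus>\<^bsub>T\<^esub> y) \<oplus>\<^bsub>T\<^esub> y \<in> P" using x(2) by (rule P.a_closed)
    moreover have "(x \<oplus>\<^bsub>T\<^esub> \<ominus>\<^bsub>T\<^esub> y) \<oplus>\<^bsub>T\<^esub> y = x"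
      using x(1) y by (simp add: R.a_assoc R.l_neg)
    ultimately show ?thesis by simp
  qed
  then show ?thesis by (auto simp: preimage_def)
qed

lemma prime_or_unit_ideal_eq_preimage:
  assumes "prime_or_unit_ideal P T"
  obtains Q where "P = preimage Q" "prime_or_unit_ideal Q R"
proof -
  have "ideal (f ` P) R" using assms ideal_image by (simp add: prime_or_unit_ideal_def)
  with assms preimage_image_prime[OF assms] prime_or_unit_preimage_iff[of "f ` P"] that[of "f ` P"]
  show thesis by simp
qed

lemma nc_prime_preimage_iff:
  assumes "ideal Q R"
  shows "nc_prime_ideal (preimage Q) T \<longleftrightarrow> nc_prime_ideal Q R"
proof -
  interpret Q: ideal Q R by fact
  have "preimage Q = carrier T \<longleftrightarrow> Q = carrier R"
    using image_preimage[OF Q.a_subset] surj preimage_carrier by metis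
  then show ?thesis
    using assms by (simp add: nc_prime_ideal_iff prime_or_unit_preimage_iff)
qed

lemma nc_prime_ideal_eq_preimage:
  assumes "nc_prime_ideal P T"
  shows "P = preimage (f ` P)" "nc_prime_ideal (f ` P) R"
proof -
  show eq: "P = preimage (f ` P)" using assms preimage_image_prime by (simp add: nc_prime_ideal_iff)
  have "ideal (f ` P) R" using assms ideal_image by (simp add: nc_prime_ideal_def)
  then show "nc_prime_ideal (f ` P) R" using nc_prime_preimage_iff assms eq by metis
qed

text \<open>This is the first isomorphism theorem for the composition of \<open>f\<close> with \<open>R \<rightarrow> R/Q\<close>.\<close>
lemma Quot_preimage_iso:
  assumes Q: "ideal Q R"
  shows "T Quot (preimage Q) \<simeq> R Quot Q"
proof -
  interpret Q: ideal Q R by fact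
  interpret q: ring_hom_ring R "R Quot Q" "(+>\<^bsub>R\<^esub>) Q" by (rule Q.rcos_ring_hom_ring)
  interpret g: ring_hom_ring T "R Quot Q" "(+>\<^bsub>R\<^esub>) Q \<circ> f"
    by (rule ring_hom_ringI2[OF R.ring_axioms Q.quotient_is_ring ring_hom_trans[OF homh q.homh]])
  have "((+>\<^bsub>R\<^esub>) Q \<circ> f) ` carrier T = carrier (R Quot Q)"
    unfolding image_comp[symmetric] surj rcos_surj ..
  moreover have "Q +>\<^bsub>R\<^esub> f x = Q \<longleftrightarrow> f x \<in> Q" if "x \<in> carrier T" for x
    using Q.rcos_const_imp_mem[OF hom_closed[OF that]] Q.a_rcos_const by metis
  then have "a_kernel T (R Quot Q) ((+>\<^bsub>R\<^esub>) Q \<circ> f) = preimage Q"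
    unfolding a_kernel_def' preimage_def zero_Quot comp_def by (intro Collect_cong conj_cong refl)
  ultimately show ?thesis using g.FactRing_iso by simp
qed

text \<open>All ideals of \<open>T\<close> whose factor is in the class are preimages, because these factors are
  prime; and the preimage of an intersection is the intersection of the preimages.\<close>
lemma special_radical_eq_preimage:
  assumes \<M>: "special_class \<M>"
  shows "special_radical \<M> T = preimage (special_radical \<M> R)"
proof -
  have *: "(nu_ideal (preimage Q) T \<and> (\<exists>B\<in>\<M>. nu_iso (T Quot preimage Q) B))
      \<longleftrightarrow> (nu_ideal Q R \<and> (\<exists>B\<in>\<M>. nu_iso (R Quot Q) B))" if Q: "ideal Q R" for Q
  proof -
    have 1: "ring (T Quot preimage Q)" using Q ideal_preimage ideal.quotient_is_ring by blast
    have "nu_iso (T Quot preimage Q) (R Quot Q)" "nu_iso (R Quot Q) (T Quot preimage Q)"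
      using Quot_preimage_iso[OF Q] ring_iso_sym[OF 1] by (auto intro: ring_iso_imp_nu_iso)
    then show ?thesis
      using Q ideal_preimage nu_iso_trans by (metis R.ring_axioms S.ring_axioms nu_ideal_iff_ideal)
  qed
  have T: "\<exists>Q. ideal Q R \<and> I = preimage Q" if I: "nu_ideal I T" "B \<in> \<M>" "nu_iso (T Quot I) B" for I B
  proof -
    have "prime_or_unit_ideal I T"
      using I \<M> nu_prime_factor R.ring_axioms unfolding special_class_def by blast
    then show ?thesis
      by (metis prime_or_unit_ideal_eq_preimage prime_or_unit_ideal_def)
  qed
  have "{I. nu_ideal I T \<and> (\<exists>B\<in>\<M>. nu_iso (T Quot I) B)}
      = preimage ` {I. nu_ideal I R \<and> (\<exists>B\<in>\<M>. nu_iso (R Quot I) B)}"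
    using * T nu_ideal_iff_ideal[OF S.ring_axioms] by (auto simp: image_iff) metis+
  then show ?thesis
    by (auto simp: special_radical_def preimage_def)
qed

lemma classical_Krull_dim_eq: "classical_Krull_dim T = classical_Krull_dim R"
proof -
  have "(\<exists>P. (\<forall>i\<le>m. nc_prime_ideal (P i) T) \<and> (\<forall>i<m. P i \<subset> P (Suc i)))
    \<longleftrightarrow> (\<exists>P. (\<forall>i\<le>m. nc_prime_ideal (P i) R) \<and> (\<forall>i<m. P i \<subset> P (Suc i)))" for m
  proof
    assume "\<exists>P. (\<forall>i\<le>m. nc_prime_ideal (P i) T) \<and> (\<forall>i<m. P i \<subset> P (Suc i))"
    then obtain P where P: "\<forall>i\<le>m. nc_prime_ideal (P i) T" "\<forall>i<m. P i \<subset> P (Suc i)" by (elim exE conjE)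
    have "f ` P i \<subset> f ` P (Suc i)" if "i < m" for i
    proof -
      have "P i = preimage (f ` P i)" "P (Suc i) = preimage (f ` P (Suc i))"
        using P(1) that by (intro nc_prime_ideal_eq_preimage(1); simp)+
      moreover have "P i \<subset> P (Suc i)" using P(2) that by blast
      ultimately show ?thesis by (metis image_mono psubset_eq)
    qed
    then show "\<exists>P. (\<forall>i\<le>m. nc_prime_ideal (P i) R) \<and> (\<forall>i<m. P i \<subset> P (Suc i))"
      using P(1) nc_prime_ideal_eq_preimage(2) by (intro exI[of _ "\<lambda>i. f ` P i"]) auto
  next
    assume "\<exists>P. (\<forall>i\<le>m. nc_prime_ideal (P i) R) \<and> (\<forall>i<m. P i \<subset> P (Suc i))"
    then obtain Q where Q: "\<forall>i\<le>m. nc_prime_ideal (Q i) R" "\<forall>i<m. Q i \<subset> Q (Suc i)" by (elim exE conjE)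
    have id: "ideal (Q i) R" if "i \<le> m" for i
      using Q(1) that nc_prime_ideal_imp_ideal by blast
    have sub: "Q i \<subseteq> carrier R" if "i \<le> m" for i
      using ideal.Icarr[OF id[OF that]] by blast
    have "preimage (Q i) \<subset> preimage (Q (Suc i))" if "i < m" for i
    proof -
      have "Q i \<subset> Q (Suc i)" using Q(2) that by blast
      then show ?thesis
        using preimage_subset_iff[OF sub[of i]] preimage_subset_iff[OF sub[of "Suc i"]] that
        by (simp add: less_le_not_le)
    qed
    then show "\<exists>P. (\<forall>i\<le>m. nc_prime_ideal (P i) T) \<and> (\<forall>i<m. P i \<subset> P (Suc i))"
      using Q(1) id by (intro exI[of _ "\<lambda>i. preimage (Q i)"]) (auto simp: nc_prime_preimage_iff)
  qed
  then show ?thesis by (simp add: classical_Krull_dim_def)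
qed

lemma prime_factors_have_iff:
  "(\<forall>P. nc_prime_ideal P T \<longrightarrow> copy_has C (T Quot P))
    \<longleftrightarrow> (\<forall>Q. nc_prime_ideal Q R \<longrightarrow> copy_has C (R Quot Q))"
proof -
  have *: "copy_has C (T Quot preimage Q) \<longleftrightarrow> copy_has C (R Quot Q)" if "nc_prime_ideal Q R" for Q
    using that by (intro copy_has_cong Quot_preimage_iso ideal.quotient_is_ring ideal_preimage)
      (auto simp: nc_prime_ideal_def)
  show ?thesis
  proof (intro iffI allI impI)
    fix P assume "\<forall>Q. nc_prime_ideal Q R \<longrightarrow> copy_has C (R Quot Q)" "nc_prime_ideal P T"
    then show "copy_has C (T Quot P)" using nc_prime_ideal_eq_preimage[of P] * by metis
  next
    fix Q assume "\<forall>P. nc_prime_ideal P T \<longrightarrow> copy_has C (T Quot P)" "nc_prime_ideal Q R"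
    then show "copy_has C (R Quot Q)"
      using * nc_prime_preimage_iff[OF nc_prime_ideal_imp_ideal] by blast
  qed
qed

end

section \<open>Additivity of pure tensors\<close>

lemma bimodule_regular:
  assumes "ring R" shows "bimodule R R (regular_bimodule R)"
proof -
  interpret ring R by fact
  have "abelian_group (regular_bimodule R)"
    by (rule abelian_groupI) (auto simp: regular_bimodule_def a_ac intro: l_neg)
  then show ?thesis
    by (intro bimodule.intro bimodule_axioms.intro ring_axioms)
      (simp_all add: regular_bimodule_def l_distr r_distr m_assoc)
qed

context
  fixes R :: "('r, 'b) ring_scheme" and S :: "('s, 'c) ring_scheme" and T :: "('t, 'd) ring_scheme"
    and V :: "('r, 's, 'm) bimodule" and W :: "('s, 't, 'k) bimodule"
  assumes V: "bimodule R S V" and W: "bimodule S T W"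
begin

lemma normal_tensor_subgroup:
  "tensor_subgroup V S W \<lhd> free_Abelian_group (carrier V \<times> carrier W)"
proof -
  interpret V: bimodule R S V by (rule V)
  interpret W: bimodule S T W by (rule W)
  interpret F: comm_group "free_Abelian_group (carrier V \<times> carrier W)"
    by (rule abelian_free_Abelian_group)
  have diff: "a - b \<in> carrier (free_Abelian_group X)"
    if "a \<in> carrier (free_Abelian_group X)" "b \<in> carrier (free_Abelian_group X)"
    for a b :: "('m \<times> 'k) \<Rightarrow>\<^sub>0 int" and X
    using that keys_diff[of a b] by auto
  have "tensor_relators V S W \<subseteq> carrier (free_Abelian_group (carrier V \<times> carrier W))"
    unfolding tensor_relators_def
    by (auto intro!: diff simp del: carrier_free_Abelian_group_iff
        simp: V.rsmult_closed W.lsmult_closed)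
  then show ?thesis
    unfolding tensor_subgroup_def by (intro F.subgroup_imp_normal F.generate_is_subgroup)
qed

lemma pure_tensor_closed:
  assumes "x \<in> carrier V" "y \<in> carrier W"
  shows "pure_tensor V S W x y \<in> carrier (tensor_product V S W)"
  using assms
  by (auto simp: pure_tensor_def tensor_product_def Let_def FactGroup_def RCOSETS_def
      simp del: carrier_free_Abelian_group_iff intro!: bexI[of _ "frag_of (x, y)"])

text \<open>If \<open>c - a - b\<close> is one of the defining relators, the cosets of \<open>c\<close> and of \<open>a + b\<close> coincide.
  Stated for pairs, this covers additivity in either factor.\<close>
lemma pure_tensor_add_eq:
  assumes a: "a \<in> carrier V \<times> carrier W" and b: "b \<in> carrier V \<times> carrier W"
    and c: "c \<in> carrier V \<times> carrier W"
    and rel: "frag_of c - frag_of a - frag_of b \<in> tensor_relators V S W"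
  shows "case_prod (pure_tensor V S W) c =
    case_prod (pure_tensor V S W) a \<oplus>\<^bsub>tensor_product V S W\<^esub> case_prod (pure_tensor V S W) b"
proof -
  define F where "F = free_Abelian_group (carrier V \<times> carrier W)"
  define H where "H = tensor_subgroup V S W"
  interpret H: normal H F
    unfolding H_def F_def by (rule normal_tensor_subgroup)
  have carr: "frag_of a \<in> carrier F" "frag_of b \<in> carrier F" "frag_of c \<in> carrier F"
    unfolding F_def frag_of_in_free_Abelian_group by fact+
  have "frag_of c - frag_of a - frag_of b \<in> H"
    using rel unfolding H_def tensor_subgroup_def by (rule generate.incl)
  moreover have "frag_of c = (frag_of c - frag_of a - frag_of b) \<otimes>\<^bsub>F\<^esub> (frag_of a \<otimes>\<^bsub>F\<^esub> frag_of b)"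
    by (simp add: F_def)
  ultimately have "frag_of c \<in> H #>\<^bsub>F\<^esub> (frag_of a \<otimes>\<^bsub>F\<^esub> frag_of b)"
    using carr by (metis H.rcosI H.m_closed H.subset)
  then have "H #>\<^bsub>F\<^esub> frag_of c = H #>\<^bsub>F\<^esub> (frag_of a \<otimes>\<^bsub>F\<^esub> frag_of b)"
    using carr H.repr_independence H.subgroup_axioms H.m_closed by metis
  also have "\<dots> = (H #>\<^bsub>F\<^esub> frag_of a) <#>\<^bsub>F\<^esub> (H #>\<^bsub>F\<^esub> frag_of b)"
    using carr H.rcos_sum by simp
  finally show ?thesis
    by (cases a; cases b; cases c)
      (simp add: pure_tensor_def tensor_product_def Let_def FactGroup_def F_def H_def)
qed

lemma pure_tensor_add_left:
  assumes "x \<in> carrier V" "x' \<in> carrier V" "y \<in> carrier W"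
  shows "pure_tensor V S W (x \<oplus>\<^bsub>V\<^esub> x') y =
    pure_tensor V S W x y \<oplus>\<^bsub>tensor_product V S W\<^esub> pure_tensor V S W x' y"
proof -
  interpret V: bimodule R S V by (rule V)
  have "frag_of (x \<oplus>\<^bsub>V\<^esub> x', y) - frag_of (x, y) - frag_of (x', y) \<in> tensor_relators V S W"
    unfolding tensor_relators_def using assms by blast
  then show ?thesis
    using assms pure_tensor_add_eq[of "(x, y)" "(x', y)" "(x \<oplus>\<^bsub>V\<^esub> x', y)"] by simp
qed

lemma pure_tensor_add_right:
  assumes "x \<in> carrier V" "y \<in> carrier W" "y' \<in> carrier W"
  shows "pure_tensor V S W x (y \<oplus>\<^bsub>W\<^esub> y') =
    pure_tensor V S W x y \<oplus>\<^bsub>tensor_product V S W\<^esub> pure_tensor V S W x y'"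
proof -
  interpret W: bimodule S T W by (rule W)
  have "frag_of (x, y \<oplus>\<^bsub>W\<^esub> y') - frag_of (x, y) - frag_of (x, y') \<in> tensor_relators V S W"
    unfolding tensor_relators_def using assms by blast
  then show ?thesis
    using assms pure_tensor_add_eq[of "(x, y)" "(x, y')" "(x, y \<oplus>\<^bsub>W\<^esub> y')"] by simp
qed

end

section \<open>Generalized matrix rings are rings\<close>

lemma (in abelian_monoid) finsum_eq_single:
  assumes "finite I" "i \<in> I" "f i \<in> carrier G" "\<And>j. \<lbrakk>j \<in> I; j \<noteq> i\<rbrakk> \<Longrightarrow> f j = \<zero>"
  shows "finsum G f I = f i"
proof -
  have carr: "f j \<in> carrier G" if "j \<in> I" for j
    using assms that by (cases "j = i") auto
  then have "finsum G f I = finsum G (\<lambda>j. if i = j then f j else \<zero>) I"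
    using assms by (intro finsum_cong') auto
  also have "\<dots> = f i" using assms carr by (intro finsum_singleton) auto
  finally show ?thesis .
qed

lemma (in abelian_monoid) finsum_swap:
  assumes "finite I" "finite J" "\<And>i j. \<lbrakk>i \<in> I; j \<in> J\<rbrakk> \<Longrightarrow> f i j \<in> carrier G"
  shows "(\<Oplus>i\<in>I. \<Oplus>j\<in>J. f i j) = (\<Oplus>j\<in>J. \<Oplus>i\<in>I. f i j)"
  using assms(1,3)
proof (induction I)
  case (insert x F)
  have "(\<Oplus>j\<in>J. \<Oplus>i\<in>insert x F. f i j) = (\<Oplus>j\<in>J. f x j \<oplus> (\<Oplus>i\<in>F. f i j))"
    using insert by (intro finsum_cong') (auto intro!: finsum_insert)
  also have "\<dots> = (\<Oplus>j\<in>J. f x j) \<oplus> (\<Oplus>j\<in>J. \<Oplus>i\<in>F. f i j)"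
    using insert by (intro finsum_addf) auto
  also have "\<dots> = (\<Oplus>i\<in>insert x F. \<Oplus>j\<in>J. f i j)"
    using insert by (subst finsum_insert) auto
  finally show ?case by simp
qed (simp add: add.finprod_one_eqI)

lemma (in abelian_group_hom) hom_finsum_additive:
  assumes "finite I" "\<And>i. i \<in> I \<Longrightarrow> f i \<in> carrier G"
  shows "h (finsum G f I) = (\<Oplus>\<^bsub>H\<^esub>i\<in>I. h (f i))"
  using assms
proof (induction I)
  case (insert x F)
  have "h (finsum G f (insert x F)) = h (f x \<oplus> finsum G f F)"
    using insert by (subst G.finsum_insert) auto
  also have "\<dots> = h (f x) \<oplus>\<^bsub>H\<^esub> (\<Oplus>\<^bsub>H\<^esub>i\<in>F. h (f i))"
    using insert by (subst hom_add) auto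
  also have "\<dots> = (\<Oplus>\<^bsub>H\<^esub>i\<in>insert x F. h (f i))"
    using insert by (subst H.finsum_insert) auto
  finally show ?case .
qed simp

lemma abelian_group_homI_add:
  assumes "abelian_group G" "abelian_group H"
    and "\<And>x. x \<in> carrier G \<Longrightarrow> h x \<in> carrier H"
    and "\<And>x y. \<lbrakk>x \<in> carrier G; y \<in> carrier G\<rbrakk> \<Longrightarrow> h (x \<oplus>\<^bsub>G\<^esub> y) = h x \<oplus>\<^bsub>H\<^esub> h y"
  shows "abelian_group_hom G H h"
proof -
  interpret G: abelian_group G by fact
  interpret H: abelian_group H by fact
  show ?thesis
    using assms by (intro abelian_group_homI group_hom.intro group_hom_axioms.intro
      G.a_group H.a_group) (auto simp: hom_def)
qed

context generalized_matrix_data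
begin

abbreviation "E \<equiv> gm_entry D M"
abbreviation "P \<equiv> gm_prod D M \<theta>"
abbreviation "T \<equiv> gm_ring n D M \<theta>"

lemma bimodule_entry:
  assumes "i \<in> {1..n}" "j \<in> {1..n}" shows "bimodule (D i) (D j) (E i j)"
  using assms diag_ring offdiag_bimodule bimodule_regular by (auto simp: gm_entry_def)

lemma abelian_group_entry:
  assumes "i \<in> {1..n}" "j \<in> {1..n}" shows "abelian_group (E i j)"
  using bimodule_entry[OF assms] by (rule bimodule.axioms)

lemma entry_closed [simp]:
  assumes "i \<in> {1..n}" "j \<in> {1..n}"
  shows "\<zero>\<^bsub>E i j\<^esub> \<in> carrier (E i j)"
    and "\<lbrakk>x \<in> carrier (E i j); y \<in> carrier (E i j)\<rbrakk> \<Longrightarrow> x \<oplus>\<^bsub>E i j\<^esub> y \<in> carrier (E i j)"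
proof -
  interpret abelian_group "E i j" using assms by (rule abelian_group_entry)
  show "\<zero>\<^bsub>E i j\<^esub> \<in> carrier (E i j)"
    and "\<lbrakk>x \<in> carrier (E i j); y \<in> carrier (E i j)\<rbrakk> \<Longrightarrow> x \<oplus>\<^bsub>E i j\<^esub> y \<in> carrier (E i j)"
    by simp_all
qed

lemma entry_diag: "carrier (E i i) = carrier (D i)" "\<zero>\<^bsub>E i i\<^esub> = \<zero>\<^bsub>D i\<^esub>"
  by (simp_all add: gm_entry_def regular_bimodule_def)

lemma one_entry_closed: "i \<in> {1..n} \<Longrightarrow> \<one>\<^bsub>D i\<^esub> \<in> carrier (E i i)"
  using diag_ring[of i] by (simp add: entry_diag ring.ring_simprules)

context
  fixes i j k assumes ijk: "i \<in> {1..n}" "j \<in> {1..n}" "k \<in> {1..n}"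
begin

lemma theta_hom_add:
  "\<theta> i j k \<in> hom (add_monoid (tensor_product (E i j) (D j) (E j k))) (add_monoid (E i k))"
  using theta_hom[OF ijk] by (simp add: bimodule_hom_def)

lemma prod_closed [simp]:
  assumes "x \<in> carrier (E i j)" "y \<in> carrier (E j k)"
  shows "P i j k x y \<in> carrier (E i k)"
  using hom_carrier[OF theta_hom_add]
    pure_tensor_closed[OF bimodule_entry[OF ijk(1,2)] bimodule_entry[OF ijk(2,3)] assms]
  by (auto simp: gm_prod_def)

lemma prod_add_left:
  assumes "x \<in> carrier (E i j)" "x' \<in> carrier (E i j)" "y \<in> carrier (E j k)"
  shows "P i j k (x \<oplus>\<^bsub>E i j\<^esub> x') y = P i j k x y \<oplus>\<^bsub>E i k\<^esub> P i j k x' y"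
  using hom_mult[OF theta_hom_add] assms
    pure_tensor_add_left[OF bimodule_entry[OF ijk(1,2)] bimodule_entry[OF ijk(2,3)]]
    pure_tensor_closed[OF bimodule_entry[OF ijk(1,2)] bimodule_entry[OF ijk(2,3)]]
  by (simp add: gm_prod_def)

lemma prod_add_right:
  assumes "x \<in> carrier (E i j)" "y \<in> carrier (E j k)" "y' \<in> carrier (E j k)"
  shows "P i j k x (y \<oplus>\<^bsub>E j k\<^esub> y') = P i j k x y \<oplus>\<^bsub>E i k\<^esub> P i j k x y'"
  using hom_mult[OF theta_hom_add] assms
    pure_tensor_add_right[OF bimodule_entry[OF ijk(1,2)] bimodule_entry[OF ijk(2,3)]]
    pure_tensor_closed[OF bimodule_entry[OF ijk(1,2)] bimodule_entry[OF ijk(2,3)]]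
  by (simp add: gm_prod_def)

lemma prod_hom_left:
  "y \<in> carrier (E j k) \<Longrightarrow> abelian_group_hom (E i j) (E i k) (\<lambda>x. P i j k x y)"
  using ijk by (intro abelian_group_homI_add abelian_group_entry) (auto simp: prod_add_left)

lemma prod_hom_right:
  "x \<in> carrier (E i j) \<Longrightarrow> abelian_group_hom (E j k) (E i k) (P i j k x)"
  using ijk by (intro abelian_group_homI_add abelian_group_entry) (auto simp: prod_add_right)

lemma prod_zero [simp]:
  "y \<in> carrier (E j k) \<Longrightarrow> P i j k \<zero>\<^bsub>E i j\<^esub> y = \<zero>\<^bsub>E i k\<^esub>"
  "x \<in> carrier (E i j) \<Longrightarrow> P i j k x \<zero>\<^bsub>E j k\<^esub> = \<zero>\<^bsub>E i k\<^esub>"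
  using abelian_group_hom.hom_zero[OF prod_hom_left] abelian_group_hom.hom_zero[OF prod_hom_right]
  by auto

end

lemma prod_one:
  assumes "i \<in> {1..n}" "j \<in> {1..n}" "x \<in> carrier (E i j)"
  shows "P i i j \<one>\<^bsub>D i\<^esub> x = x" "P i j j x \<one>\<^bsub>D j\<^esub> = x"
proof -
  interpret Di: ring "D i" using assms diag_ring by simp
  interpret Dj: ring "D j" using assms diag_ring by simp
  have "P i i j \<one>\<^bsub>D i\<^esub> x = x \<and> P i j j x \<one>\<^bsub>D j\<^esub> = x"
  proof (cases "i = j")
    case True
    then show ?thesis using assms theta_diag by (simp add: entry_diag)
  next
    case False
    then interpret bimodule "D i" "D j" "M i j" using offdiag_bimodule assms by simp
    show ?thesis
      using False assms theta_lsmult theta_rsmult lsmult_one rsmult_one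
      by (simp add: gm_entry_def)
  qed
  then show "P i i j \<one>\<^bsub>D i\<^esub> x = x" "P i j j x \<one>\<^bsub>D j\<^esub> = x" by auto
qed

lemma gm_carrier_iff:
  "t \<in> carrier T \<longleftrightarrow>
    t \<in> extensional ({1..n} \<times> {1..n}) \<and> (\<forall>i\<in>{1..n}. \<forall>j\<in>{1..n}. t (i, j) \<in> carrier (E i j))"
  by (auto simp: gm_ring_def PiE_iff)

lemma gm_carrier_entry [simp]:
  "\<lbrakk>t \<in> carrier T; i \<in> {1..n}; j \<in> {1..n}\<rbrakk> \<Longrightarrow> t (i, j) \<in> carrier (E i j)"
  by (auto simp: gm_carrier_iff)

lemma gm_eqI:
  assumes "s \<in> carrier T" "t \<in> carrier T"
    and "\<And>i j. \<lbrakk>i \<in> {1..n}; j \<in> {1..n}\<rbrakk> \<Longrightarrow> s (i, j) = t (i, j)"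
  shows "s = t"
  using assms by (intro extensionalityI[of s "{1..n} \<times> {1..n}" t]) (auto simp: gm_carrier_iff)

lemma gm_entries:
  assumes "i \<in> {1..n}" "k \<in> {1..n}"
  shows gm_add_entry: "(s \<oplus>\<^bsub>T\<^esub> t) (i, k) = s (i, k) \<oplus>\<^bsub>E i k\<^esub> t (i, k)"
    and gm_zero_entry: "\<zero>\<^bsub>T\<^esub> (i, k) = \<zero>\<^bsub>E i k\<^esub>"
    and gm_one_entry: "\<one>\<^bsub>T\<^esub> (i, k) = (if i = k then \<one>\<^bsub>D i\<^esub> else \<zero>\<^bsub>E i k\<^esub>)"
    and gm_mult_entry:
      "(s \<otimes>\<^bsub>T\<^esub> t) (i, k) = (\<Oplus>\<^bsub>E i k\<^esub>j\<in>{1..n}. P i j k (s (i, j)) (t (j, k)))"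
  using assms by (auto simp: gm_ring_def gm_entry_def)

lemma gm_closed:
  assumes "s \<in> carrier T" "t \<in> carrier T"
  shows gm_add_closed: "s \<oplus>\<^bsub>T\<^esub> t \<in> carrier T"
    and gm_mult_closed: "s \<otimes>\<^bsub>T\<^esub> t \<in> carrier T"
proof -
  show "s \<oplus>\<^bsub>T\<^esub> t \<in> carrier T"
    unfolding gm_carrier_iff using assms by (auto simp: gm_add_entry) (auto simp: gm_ring_def)
  have "(s \<otimes>\<^bsub>T\<^esub> t) (i, k) \<in> carrier (E i k)" if ik: "i \<in> {1..n}" "k \<in> {1..n}" for i k
  proof -
    interpret abelian_group "E i k" using ik by (rule abelian_group_entry)
    show ?thesis using assms ik by (auto simp: gm_mult_entry intro!: finsum_closed)
  qed
  then show "s \<otimes>\<^bsub>T\<^esub> t \<in> carrier T"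
    unfolding gm_carrier_iff by (auto simp: gm_ring_def)
qed

lemma gm_one_zero_closed: "\<one>\<^bsub>T\<^esub> \<in> carrier T" "\<zero>\<^bsub>T\<^esub> \<in> carrier T"
  unfolding gm_carrier_iff
  by (auto simp: gm_one_entry gm_zero_entry one_entry_closed) (auto simp: gm_ring_def)

lemma abelian_group_gm_ring: "abelian_group T"
proof (rule abelian_groupI)
  fix x y z assume x: "x \<in> carrier T" and y: "y \<in> carrier T" and z: "z \<in> carrier T"
  show "x \<oplus>\<^bsub>T\<^esub> y \<in> carrier T" using x y by (rule gm_add_closed)
  show "x \<oplus>\<^bsub>T\<^esub> y \<oplus>\<^bsub>T\<^esub> z = x \<oplus>\<^bsub>T\<^esub> (y \<oplus>\<^bsub>T\<^esub> z)"
    using x y z abelian_group_entry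
    by (intro gm_eqI gm_add_closed) (simp_all add: gm_add_entry abelian_groupE(3))
  show "x \<oplus>\<^bsub>T\<^esub> y = y \<oplus>\<^bsub>T\<^esub> x"
    using x y abelian_group_entry
    by (intro gm_eqI gm_add_closed) (simp_all add: gm_add_entry abelian_groupE(4))
next
  fix x assume x: "x \<in> carrier T"
  show "\<zero>\<^bsub>T\<^esub> \<oplus>\<^bsub>T\<^esub> x = x"
    using x abelian_group_entry
    by (intro gm_eqI gm_add_closed gm_one_zero_closed)
      (simp_all add: gm_add_entry gm_zero_entry abelian_groupE(5))
  define y where "y = (\<lambda>(i, j)\<in>{1..n} \<times> {1..n}. \<ominus>\<^bsub>E i j\<^esub> x (i, j))"
  have y: "y \<in> carrier T"
    using x abelian_group.a_inv_closed[OF abelian_group_entry]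
    by (auto simp: gm_carrier_iff y_def)
  moreover have "y \<oplus>\<^bsub>T\<^esub> x = \<zero>\<^bsub>T\<^esub>"
    using x y abelian_group.l_neg[OF abelian_group_entry]
    by (intro gm_eqI gm_add_closed gm_one_zero_closed)
      (simp_all add: gm_add_entry gm_zero_entry, simp add: y_def)
  ultimately show "\<exists>y\<in>carrier T. y \<oplus>\<^bsub>T\<^esub> x = \<zero>\<^bsub>T\<^esub>" by blast
qed (rule gm_one_zero_closed)

text \<open>Both sides expand to double sums of the terms \<open>a\<^sub>i\<^sub>j (b\<^sub>j\<^sub>k c\<^sub>k\<^sub>l)\<close>, over \<open>k\<close> and \<open>j\<close> in opposite
  orders.\<close>
lemma gm_mult_assoc:
  assumes a: "a \<in> carrier T" and b: "b \<in> carrier T" and c: "c \<in> carrier T"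
  shows "a \<otimes>\<^bsub>T\<^esub> b \<otimes>\<^bsub>T\<^esub> c = a \<otimes>\<^bsub>T\<^esub> (b \<otimes>\<^bsub>T\<^esub> c)"
proof (intro gm_eqI gm_mult_closed assms)
  fix i l assume il: "i \<in> {1..n}" "l \<in> {1..n}"
  interpret Eil: abelian_group "E i l" using il by (rule abelian_group_entry)
  let ?t = "\<lambda>j k. P i j l (a (i, j)) (P j k l (b (j, k)) (c (k, l)))"
  have "(a \<otimes>\<^bsub>T\<^esub> b \<otimes>\<^bsub>T\<^esub> c) (i, l) = (\<Oplus>\<^bsub>E i l\<^esub>k\<in>{1..n}. \<Oplus>\<^bsub>E i l\<^esub>j\<in>{1..n}. ?t j k)"
  proof -
    have "P i k l ((a \<otimes>\<^bsub>T\<^esub> b) (i, k)) (c (k, l)) = (\<Oplus>\<^bsub>E i l\<^esub>j\<in>{1..n}. ?t j k)"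
      if k: "k \<in> {1..n}" for k
    proof -
      interpret h: abelian_group_hom "E i k" "E i l" "\<lambda>x. P i k l x (c (k, l))"
        using il k c by (intro prod_hom_left) auto
      have "P i k l ((a \<otimes>\<^bsub>T\<^esub> b) (i, k)) (c (k, l)) =
          (\<Oplus>\<^bsub>E i l\<^esub>j\<in>{1..n}. P i k l (P i j k (a (i, j)) (b (j, k))) (c (k, l)))"
        unfolding gm_mult_entry[OF il(1) k] using il k a b c by (intro h.hom_finsum_additive) auto
      also have "\<dots> = (\<Oplus>\<^bsub>E i l\<^esub>j\<in>{1..n}. ?t j k)"
        using il k a b c by (intro Eil.finsum_cong') (auto simp: theta_assoc)
      finally show ?thesis .
    qed
    then show ?thesis
      unfolding gm_mult_entry[OF il] using il a b c
      by (intro Eil.finsum_cong') (auto intro!: Eil.finsum_closed)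
  qed
  also have "\<dots> = (\<Oplus>\<^bsub>E i l\<^esub>j\<in>{1..n}. \<Oplus>\<^bsub>E i l\<^esub>k\<in>{1..n}. ?t j k)"
    using il a b c by (intro Eil.finsum_swap) auto
  also have "\<dots> = (a \<otimes>\<^bsub>T\<^esub> (b \<otimes>\<^bsub>T\<^esub> c)) (i, l)"
  proof -
    have "P i j l (a (i, j)) ((b \<otimes>\<^bsub>T\<^esub> c) (j, l)) = (\<Oplus>\<^bsub>E i l\<^esub>k\<in>{1..n}. ?t j k)"
      if j: "j \<in> {1..n}" for j
    proof -
      interpret h: abelian_group_hom "E j l" "E i l" "P i j l (a (i, j))"
        using il j a by (intro prod_hom_right) auto
      show ?thesis
        unfolding gm_mult_entry[OF j il(2)] using il j a b c by (intro h.hom_finsum_additive) auto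
    qed
    then show ?thesis
      unfolding gm_mult_entry[OF il] using il a b c
      by (intro Eil.finsum_cong') (auto intro!: Eil.finsum_closed)
  qed
  finally show "(a \<otimes>\<^bsub>T\<^esub> b \<otimes>\<^bsub>T\<^esub> c) (i, l) = (a \<otimes>\<^bsub>T\<^esub> (b \<otimes>\<^bsub>T\<^esub> c)) (i, l)" .
qed

lemma gm_mult_one:
  assumes a: "a \<in> carrier T"
  shows "\<one>\<^bsub>T\<^esub> \<otimes>\<^bsub>T\<^esub> a = a" "a \<otimes>\<^bsub>T\<^esub> \<one>\<^bsub>T\<^esub> = a"
proof -
  show "\<one>\<^bsub>T\<^esub> \<otimes>\<^bsub>T\<^esub> a = a"
  proof (intro gm_eqI gm_mult_closed gm_one_zero_closed assms)
    fix i k assume ik: "i \<in> {1..n}" "k \<in> {1..n}"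
    interpret abelian_group "E i k" using ik by (rule abelian_group_entry)
    have "(\<one>\<^bsub>T\<^esub> \<otimes>\<^bsub>T\<^esub> a) (i, k) = P i i k (\<one>\<^bsub>T\<^esub> (i, i)) (a (i, k))"
      unfolding gm_mult_entry[OF ik] using ik a
      by (intro finsum_eq_single) (auto simp: gm_one_entry one_entry_closed)
    then show "(\<one>\<^bsub>T\<^esub> \<otimes>\<^bsub>T\<^esub> a) (i, k) = a (i, k)"
      using ik a by (simp add: gm_one_entry prod_one)
  qed
  show "a \<otimes>\<^bsub>T\<^esub> \<one>\<^bsub>T\<^esub> = a"
  proof (intro gm_eqI gm_mult_closed gm_one_zero_closed assms)
    fix i k assume ik: "i \<in> {1..n}" "k \<in> {1..n}"
    interpret abelian_group "E i k" using ik by (rule abelian_group_entry)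
    have "(a \<otimes>\<^bsub>T\<^esub> \<one>\<^bsub>T\<^esub>) (i, k) = P i k k (a (i, k)) (\<one>\<^bsub>T\<^esub> (k, k))"
      unfolding gm_mult_entry[OF ik] using ik a
      by (intro finsum_eq_single) (auto simp: gm_one_entry one_entry_closed)
    then show "(a \<otimes>\<^bsub>T\<^esub> \<one>\<^bsub>T\<^esub>) (i, k) = a (i, k)"
      using ik a by (simp add: gm_one_entry prod_one)
  qed
qed

lemma gm_distrib:
  assumes a: "a \<in> carrier T" and b: "b \<in> carrier T" and c: "c \<in> carrier T"
  shows "(a \<oplus>\<^bsub>T\<^esub> b) \<otimes>\<^bsub>T\<^esub> c = a \<otimes>\<^bsub>T\<^esub> c \<oplus>\<^bsub>T\<^esub> b \<otimes>\<^bsub>T\<^esub> c"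
    and "c \<otimes>\<^bsub>T\<^esub> (a \<oplus>\<^bsub>T\<^esub> b) = c \<otimes>\<^bsub>T\<^esub> a \<oplus>\<^bsub>T\<^esub> c \<otimes>\<^bsub>T\<^esub> b"
proof -
  show "(a \<oplus>\<^bsub>T\<^esub> b) \<otimes>\<^bsub>T\<^esub> c = a \<otimes>\<^bsub>T\<^esub> c \<oplus>\<^bsub>T\<^esub> b \<otimes>\<^bsub>T\<^esub> c"
  proof (intro gm_eqI gm_mult_closed gm_add_closed assms)
    fix i k assume ik: "i \<in> {1..n}" "k \<in> {1..n}"
    interpret abelian_group "E i k" using ik by (rule abelian_group_entry)
    have "((a \<oplus>\<^bsub>T\<^esub> b) \<otimes>\<^bsub>T\<^esub> c) (i, k) =
        (\<Oplus>\<^bsub>E i k\<^esub>j\<in>{1..n}. P i j k (a (i, j)) (c (j, k)) \<oplus>\<^bsub>E i k\<^esub> P i j k (b (i, j)) (c (j, k)))"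
      unfolding gm_mult_entry[OF ik] using ik a b c
      by (intro finsum_cong') (auto simp: gm_add_entry prod_add_left)
    also have "\<dots> = (a \<otimes>\<^bsub>T\<^esub> c \<oplus>\<^bsub>T\<^esub> b \<otimes>\<^bsub>T\<^esub> c) (i, k)"
      unfolding gm_add_entry[OF ik] gm_mult_entry[OF ik] using ik a b c
      by (intro finsum_addf) auto
    finally show "((a \<oplus>\<^bsub>T\<^esub> b) \<otimes>\<^bsub>T\<^esub> c) (i, k) = (a \<otimes>\<^bsub>T\<^esub> c \<oplus>\<^bsub>T\<^esub> b \<otimes>\<^bsub>T\<^esub> c) (i, k)" .
  qed
  show "c \<otimes>\<^bsub>T\<^esub> (a \<oplus>\<^bsub>T\<^esub> b) = c \<otimes>\<^bsub>T\<^esub> a \<oplus>\<^bsub>T\<^esub> c \<otimes>\<^bsub>T\<^esub> b"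
  proof (intro gm_eqI gm_mult_closed gm_add_closed assms)
    fix i k assume ik: "i \<in> {1..n}" "k \<in> {1..n}"
    interpret abelian_group "E i k" using ik by (rule abelian_group_entry)
    have "(c \<otimes>\<^bsub>T\<^esub> (a \<oplus>\<^bsub>T\<^esub> b)) (i, k) =
        (\<Oplus>\<^bsub>E i k\<^esub>j\<in>{1..n}. P i j k (c (i, j)) (a (j, k)) \<oplus>\<^bsub>E i k\<^esub> P i j k (c (i, j)) (b (j, k)))"
      unfolding gm_mult_entry[OF ik] using ik a b c
      by (intro finsum_cong') (auto simp: gm_add_entry prod_add_right)
    also have "\<dots> = (c \<otimes>\<^bsub>T\<^esub> a \<oplus>\<^bsub>T\<^esub> c \<otimes>\<^bsub>T\<^esub> b) (i, k)"
      unfolding gm_add_entry[OF ik] gm_mult_entry[OF ik] using ik a b c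
      by (intro finsum_addf) auto
    finally show "(c \<otimes>\<^bsub>T\<^esub> (a \<oplus>\<^bsub>T\<^esub> b)) (i, k) = (c \<otimes>\<^bsub>T\<^esub> a \<oplus>\<^bsub>T\<^esub> c \<otimes>\<^bsub>T\<^esub> b) (i, k)" .
  qed
qed

lemma ring_gm_ring: "ring T"
  by (intro ringI abelian_group_gm_ring monoidI gm_mult_closed gm_one_zero_closed
    gm_mult_assoc gm_mult_one gm_distrib)

end

section \<open>The diagonal projection\<close>

context generalized_matrix_data
begin

text \<open>For a singleton \<open>S\<close> these are the single-entry matrices, from which all others are built by
  addition; for \<open>S\<close> the diagonal this is the diagonal projection.\<close>
definition gm_restrict :: "(nat \<times> nat) set \<Rightarrow> (nat \<times> nat \<Rightarrow> 'a) \<Rightarrow> nat \<times> nat \<Rightarrow> 'a"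
  where "gm_restrict S t =
    (\<lambda>(i, j)\<in>{1..n} \<times> {1..n}. if (i, j) \<in> S then t (i, j) else \<zero>\<^bsub>E i j\<^esub>)"

lemma gm_restrict_entry:
  "\<lbrakk>i \<in> {1..n}; j \<in> {1..n}\<rbrakk> \<Longrightarrow>
    gm_restrict S t (i, j) = (if (i, j) \<in> S then t (i, j) else \<zero>\<^bsub>E i j\<^esub>)"
  by (simp add: gm_restrict_def)

lemma gm_restrict_closed: "t \<in> carrier T \<Longrightarrow> gm_restrict S t \<in> carrier T"
  unfolding gm_carrier_iff by (auto simp: gm_restrict_entry) (auto simp: gm_restrict_def)

text \<open>A matrix is the sum of its single-entry parts. This form of the statement serves both for
  ideals and for subrings, as it assumes of \<open>X\<close> only closure under addition.\<close>
lemma gm_restrict_in: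
  assumes t: "t \<in> carrier T" and zero: "\<zero>\<^bsub>T\<^esub> \<in> X"
    and add: "\<And>a b. \<lbrakk>a \<in> X; b \<in> X\<rbrakk> \<Longrightarrow> a \<oplus>\<^bsub>T\<^esub> b \<in> X"
    and S: "S \<subseteq> {1..n} \<times> {1..n}" and single: "\<And>p. p \<in> S \<Longrightarrow> gm_restrict {p} t \<in> X"
  shows "gm_restrict S t \<in> X"
proof -
  have "finite S" using S by (rule finite_subset) simp
  then show ?thesis using S single
  proof (induction S)
    case empty
    have "gm_restrict {} t = \<zero>\<^bsub>T\<^esub>"
      using t by (intro gm_eqI gm_restrict_closed gm_one_zero_closed)
        (auto simp: gm_restrict_entry gm_zero_entry)
    then show ?case using zero by simp
  next
    case (insert p S)
    have "gm_restrict (insert p S) t = gm_restrict {p} t \<oplus>\<^bsub>T\<^esub> gm_restrict S t"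
    proof (intro gm_eqI gm_restrict_closed gm_add_closed t)
      fix i j assume ij: "i \<in> {1..n}" "j \<in> {1..n}"
      interpret abelian_group "E i j" using ij by (rule abelian_group_entry)
      show "gm_restrict (insert p S) t (i, j) = (gm_restrict {p} t \<oplus>\<^bsub>T\<^esub> gm_restrict S t) (i, j)"
        using ij t insert.hyps by (auto simp: gm_restrict_entry gm_add_entry)
    qed
    then show ?case using insert by (auto intro: add)
  qed
qed

end

context class_T
begin

lemma prod_iji_zero:
  assumes "i \<in> {1..n}" "j \<in> {1..n}" "i \<noteq> j" "x \<in> carrier (E i j)" "y \<in> carrier (E j i)"
  shows "P i j i x y = \<zero>\<^bsub>E i i\<^esub>"
  using assms theta_iji_zero
    pure_tensor_closed[OF bimodule_entry[OF assms(1,2)] bimodule_entry[OF assms(2,1)] assms(4,5)]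
  by (simp add: gm_prod_def entry_diag)

text \<open>The column \<open>i\<close> of \<open>x t\<close> vanishes: row \<open>i\<close> is the only nonzero row of \<open>x\<close>, and
  there the entry is \<open>x\<^sub>i\<^sub>j t\<^sub>j\<^sub>i = 0\<close>. In the product with \<open>x\<close> on the right, only this column
  meets a nonzero entry of \<open>x\<close>.\<close>
lemma single_mult_single:
  assumes x: "x \<in> carrier T" and t: "t \<in> carrier T"
    and ij: "i \<in> {1..n}" "j \<in> {1..n}" "i \<noteq> j"
    and single: "\<And>a b. \<lbrakk>a \<in> {1..n}; b \<in> {1..n}; (a, b) \<noteq> (i, j)\<rbrakk> \<Longrightarrow> x (a, b) = \<zero>\<^bsub>E a b\<^esub>"
  shows "(x \<otimes>\<^bsub>T\<^esub> t) \<otimes>\<^bsub>T\<^esub> x = \<zero>\<^bsub>T\<^esub>"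
proof (intro gm_eqI gm_mult_closed gm_one_zero_closed x t)
  have col: "(x \<otimes>\<^bsub>T\<^esub> t) (a, i) = \<zero>\<^bsub>E a i\<^esub>" if a: "a \<in> {1..n}" for a
  proof -
    interpret abelian_group "E a i" using a ij(1) by (rule abelian_group_entry)
    have "P a c i (x (a, c)) (t (c, i)) = \<zero>\<^bsub>E a i\<^esub>" if c: "c \<in> {1..n}" for c
      using a c ij x t single[OF a c] prod_iji_zero[OF ij] by (cases "(a, c) = (i, j)") auto
    then show ?thesis
      unfolding gm_mult_entry[OF a ij(1)] by (rule add.finprod_one_eqI)
  qed
  fix a b assume ab: "a \<in> {1..n}" "b \<in> {1..n}"
  interpret abelian_group "E a b" using ab by (rule abelian_group_entry)
  have "P a c b ((x \<otimes>\<^bsub>T\<^esub> t) (a, c)) (x (c, b)) = \<zero>\<^bsub>E a b\<^esub>" if c: "c \<in> {1..n}" for c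
    using ab c x t single[OF c ab(2)] col[OF ab(1)] gm_mult_closed[OF x t]
    by (cases "(c, b) = (i, j)") auto
  then show "(x \<otimes>\<^bsub>T\<^esub> t \<otimes>\<^bsub>T\<^esub> x) (a, b) = \<zero>\<^bsub>T\<^esub> (a, b)"
    unfolding gm_mult_entry[OF ab] gm_zero_entry[OF ab] by (rule add.finprod_one_eqI)
qed

definition diag :: "(nat \<times> nat \<Rightarrow> 'a) \<Rightarrow> nat \<times> nat \<Rightarrow> 'a"
  where "diag = gm_restrict {(i, i) |i. i \<in> {1..n}}"

abbreviation "R \<equiv> T\<lparr>carrier := gm_diag n D M \<theta>\<rparr>"

lemma diag_entry:
  "\<lbrakk>i \<in> {1..n}; j \<in> {1..n}\<rbrakk> \<Longrightarrow> diag t (i, j) = (if i = j then t (i, j) else \<zero>\<^bsub>E i j\<^esub>)"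
  by (auto simp: diag_def gm_restrict_entry)

lemma diag_closed: "t \<in> carrier T \<Longrightarrow> diag t \<in> carrier T"
  by (simp add: diag_def gm_restrict_closed)

lemma gm_diag_iff: "t \<in> gm_diag n D M \<theta> \<longleftrightarrow> t \<in> carrier T \<and> diag t = t"
proof
  assume t: "t \<in> gm_diag n D M \<theta>"
  then have tc: "t \<in> carrier T" by (simp add: gm_diag_def)
  moreover have "diag t = t"
    using t tc by (intro gm_eqI diag_closed) (auto simp: diag_entry gm_diag_def gm_entry_def)
  ultimately show "t \<in> carrier T \<and> diag t = t" ..
next
  assume t: "t \<in> carrier T \<and> diag t = t"
  have "t (i, j) = \<zero>\<^bsub>M i j\<^esub>" if "i \<in> {1..n}" "j \<in> {1..n}" "i \<noteq> j" for i j
    using t diag_entry[OF that(1,2), of t] that(3) by (simp add: gm_entry_def)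
  then show "t \<in> gm_diag n D M \<theta>" using t by (simp add: gm_diag_def)
qed

lemma diag_diag: "t \<in> carrier T \<Longrightarrow> diag (diag t) = diag t"
  by (intro gm_eqI diag_closed) (auto simp: diag_entry)

lemma diag_add:
  assumes "s \<in> carrier T" "t \<in> carrier T"
  shows "diag (s \<oplus>\<^bsub>T\<^esub> t) = diag s \<oplus>\<^bsub>T\<^esub> diag t"
proof (intro gm_eqI diag_closed gm_add_closed assms)
  fix i j assume ij: "i \<in> {1..n}" "j \<in> {1..n}"
  interpret abelian_group "E i j" using ij by (rule abelian_group_entry)
  show "diag (s \<oplus>\<^bsub>T\<^esub> t) (i, j) = (diag s \<oplus>\<^bsub>T\<^esub> diag t) (i, j)"
    using ij by (simp add: diag_entry gm_add_entry)
qed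

lemma diag_one: "diag \<one>\<^bsub>T\<^esub> = \<one>\<^bsub>T\<^esub>"
  by (intro gm_eqI diag_closed gm_one_zero_closed) (auto simp: diag_entry gm_one_entry)

text \<open>On the diagonal, the products \<open>s\<^sub>i\<^sub>j t\<^sub>j\<^sub>i\<close> with \<open>j \<noteq> i\<close> vanish in \<open>s t\<close> because
  \<open>\<theta>\<^sub>i\<^sub>j\<^sub>i = 0\<close>.\<close>
lemma diag_mult:
  assumes s: "s \<in> carrier T" and t: "t \<in> carrier T"
  shows "diag (s \<otimes>\<^bsub>T\<^esub> t) = diag s \<otimes>\<^bsub>T\<^esub> diag t"
proof (intro gm_eqI diag_closed gm_mult_closed assms)
  fix i k assume ik: "i \<in> {1..n}" "k \<in> {1..n}"
  interpret abelian_group "E i k" using ik by (rule abelian_group_entry)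
  show "diag (s \<otimes>\<^bsub>T\<^esub> t) (i, k) = (diag s \<otimes>\<^bsub>T\<^esub> diag t) (i, k)"
  proof (cases "i = k")
    case True
    have "(s \<otimes>\<^bsub>T\<^esub> t) (i, k) = P i i k (s (i, i)) (t (i, k))"
      unfolding gm_mult_entry[OF ik] using True ik s t prod_iji_zero[of i]
      by (intro finsum_eq_single) auto
    moreover have "(diag s \<otimes>\<^bsub>T\<^esub> diag t) (i, k) = P i i k (diag s (i, i)) (diag t (i, k))"
      unfolding gm_mult_entry[OF ik] using True ik diag_closed[OF s] diag_closed[OF t] prod_iji_zero[of i]
      by (intro finsum_eq_single) auto
    ultimately show ?thesis using True ik by (simp add: diag_entry)
  next
    case False
    have "P i j k (diag s (i, j)) (diag t (j, k)) = \<zero>\<^bsub>E i k\<^esub>" if j: "j \<in> {1..n}" for j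
      using False ik j s t by (cases "i = j") (auto simp: diag_entry)
    then have "(diag s \<otimes>\<^bsub>T\<^esub> diag t) (i, k) = \<zero>\<^bsub>E i k\<^esub>"
      unfolding gm_mult_entry[OF ik] by (rule add.finprod_one_eqI)
    then show ?thesis using False ik by (simp add: diag_entry)
  qed
qed

lemma diag_zero: "diag \<zero>\<^bsub>T\<^esub> = \<zero>\<^bsub>T\<^esub>"
  by (intro gm_eqI diag_closed gm_one_zero_closed) (auto simp: diag_entry gm_zero_entry)

lemma diag_uminus:
  assumes t: "t \<in> carrier T" shows "diag (\<ominus>\<^bsub>T\<^esub> t) = \<ominus>\<^bsub>T\<^esub> diag t"
proof -
  interpret ring T by (rule ring_gm_ring)
  have "diag (\<ominus>\<^bsub>T\<^esub> t) \<oplus>\<^bsub>T\<^esub> diag t = \<zero>\<^bsub>T\<^esub>"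
    using diag_add[of "\<ominus>\<^bsub>T\<^esub> t" t] t by (simp add: l_neg diag_zero)
  then show ?thesis using t by (intro minus_equality[symmetric] diag_closed) auto
qed

lemma subring_gm_diag: "subring (gm_diag n D M \<theta>) T"
proof -
  interpret ring T by (rule ring_gm_ring)
  show ?thesis
    by (rule subringI) (auto simp: gm_diag_iff diag_one diag_uminus diag_add diag_mult)
qed

lemma ring_R: "ring R"
  using ring.subring_is_ring[OF ring_gm_ring subring_gm_diag] .

lemma diag_image: "diag ` carrier T = carrier R"
  by (auto simp: gm_diag_iff image_iff diag_closed diag_diag) metis

text \<open>A matrix with zero diagonal is a sum of single-entry matrices \<open>x\<close> with \<open>x T x = 0\<close>.\<close>
lemma kernel_diag_subset_prime:
  assumes Q: "prime_or_unit_ideal Q T"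
  shows "a_kernel T R diag \<subseteq> Q"
proof
  interpret Q: ideal Q T using Q by (simp add: prime_or_unit_ideal_def)
  let ?off = "{1..n} \<times> {1..n} - {(i, i) |i. i \<in> {1..n}}"
  fix t assume "t \<in> a_kernel T R diag"
  then have t: "t \<in> carrier T" "diag t = \<zero>\<^bsub>T\<^esub>" by (auto simp: a_kernel_def')
  have "t = gm_restrict ?off t"
  proof (intro gm_eqI gm_restrict_closed t(1))
    fix i j assume ij: "i \<in> {1..n}" "j \<in> {1..n}"
    then show "t (i, j) = gm_restrict ?off t (i, j)"
      using diag_entry[OF ij, of t] t(2) by (auto simp: gm_restrict_entry gm_zero_entry)
  qed
  also have "\<dots> \<in> Q"
  proof (rule gm_restrict_in[OF t(1)])
    fix p assume "p \<in> ?off"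
    then obtain i j where p: "p = (i, j)" and ij: "i \<in> {1..n}" "j \<in> {1..n}" "i \<noteq> j" by auto
    show "gm_restrict {p} t \<in> Q"
    proof (rule prime_or_unit_ideal_mem[OF Q gm_restrict_closed[OF t(1)]])
      fix s assume "s \<in> carrier T"
      then have "gm_restrict {p} t \<otimes>\<^bsub>T\<^esub> s \<otimes>\<^bsub>T\<^esub> gm_restrict {p} t = \<zero>\<^bsub>T\<^esub>"
        using ij t(1) by (intro single_mult_single[of _ _ i j] gm_restrict_closed)
          (auto simp: gm_restrict_entry p)
      then show "gm_restrict {p} t \<otimes>\<^bsub>T\<^esub> s \<otimes>\<^bsub>T\<^esub> gm_restrict {p} t \<in> Q"
        by (simp only: additive_subgroup.zero_closed[OF Q.additive_subgroup_axioms])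
    qed
  qed auto
  finally show "t \<in> Q" .
qed

lemma prime_reflecting_diag: "prime_reflecting_hom T R diag"
proof -
  have "ring_hom_ring T R diag"
    using diag_image
    by (intro ring_hom_ringI ring_gm_ring ring_R) (auto simp: diag_add diag_mult diag_one)
  then show ?thesis
    by (intro prime_reflecting_hom.intro prime_reflecting_hom_axioms.intro
      diag_image kernel_diag_subset_prime)
qed

text \<open>The off-diagonal single-entry matrix \<open>x\<close> at \<open>(k, j)\<close> is written as \<open>(x + e\<^sub>k\<^sub>k) - e\<^sub>k\<^sub>k\<close>, with
  \<open>x + e\<^sub>k\<^sub>k \<in> \<E>\<^sub>k\<close> and \<open>e\<^sub>k\<^sub>k\<close> diagonal.\<close>
lemma generate_ring_diag_E:
  "generate_ring T (carrier R \<union> (\<Union>k\<in>{1..n}. gm_E n D M \<theta> k)) = carrier T"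
    (is "generate_ring T ?G = _")
proof
  interpret T: ring T by (rule ring_gm_ring)
  show "generate_ring T ?G \<subseteq> carrier T"
    by (rule T.generate_ring_incl) (auto simp: gm_diag_def gm_E_def)
  show "carrier T \<subseteq> generate_ring T ?G"
  proof
    fix t assume t: "t \<in> carrier T"
    have diag_in: "s \<in> generate_ring T ?G" if "s \<in> carrier T" "diag s = s" for s
      using that by (intro generate_ring.incl) (simp add: gm_diag_iff)
    have "t = gm_restrict ({1..n} \<times> {1..n}) t"
      using t by (intro gm_eqI gm_restrict_closed) (auto simp: gm_restrict_entry)
    also have "\<dots> \<in> generate_ring T ?G"
    proof (rule gm_restrict_in[OF t T.zero_in_generate generate_ring.eng_add])
      fix p assume "p \<in> {1..n} \<times> {1..n}"
      then obtain k j where p: "p = (k, j)" and kj: "k \<in> {1..n}" "j \<in> {1..n}" by auto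
      let ?x = "gm_restrict {p} t"
      have x: "?x \<in> carrier T" using t by (rule gm_restrict_closed)
      show "?x \<in> generate_ring T ?G"
      proof (cases "j = k")
        case True
        then show ?thesis
          using x p by (intro diag_in gm_eqI diag_closed) (auto simp: diag_entry gm_restrict_entry)
      next
        case False
        let ?e = "gm_restrict {(k, k)} \<one>\<^bsub>T\<^esub>"
        have e: "?e \<in> carrier T" by (intro gm_restrict_closed) simp
        have e_in: "?e \<in> generate_ring T ?G"
          using e by (intro diag_in gm_eqI diag_closed) (auto simp: diag_entry gm_restrict_entry)
        have entry: "(?x \<oplus>\<^bsub>T\<^esub> ?e) (a, b) =
            (if (a, b) = (k, j) then t (k, j) else if (a, b) = (k, k) then \<one>\<^bsub>D k\<^esub> else \<zero>\<^bsub>E a b\<^esub>)"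
          if ab: "a \<in> {1..n}" "b \<in> {1..n}" for a b
        proof -
          interpret abelian_group "E a b" using ab by (rule abelian_group_entry)
          have one: "\<zero>\<^bsub>E a b\<^esub> \<oplus>\<^bsub>E a b\<^esub> \<one>\<^bsub>D a\<^esub> = \<one>\<^bsub>D a\<^esub>" if "a = b"
            using that one_entry_closed[OF ab(1)] by (intro l_zero) simp
          show ?thesis
            using ab kj p False one l_zero[OF zero_closed] r_zero[OF gm_carrier_entry[OF t ab]]
            by (auto simp: gm_add_entry gm_restrict_entry gm_one_entry one_entry_closed)
        qed
        have "?x \<oplus>\<^bsub>T\<^esub> ?e \<in> gm_E n D M \<theta> k"
          unfolding gm_E_def using kj False gm_add_closed[OF x e] by (simp add: entry)
        then have "?x \<oplus>\<^bsub>T\<^esub> ?e \<in> generate_ring T ?G" using kj by (intro generate_ring.incl) auto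
        then have "(?x \<oplus>\<^bsub>T\<^esub> ?e) \<oplus>\<^bsub>T\<^esub> \<ominus>\<^bsub>T\<^esub> ?e \<in> generate_ring T ?G"
          by (rule generate_ring.eng_add[OF _ generate_ring.a_inv[OF e_in]])
        also have "(?x \<oplus>\<^bsub>T\<^esub> ?e) \<oplus>\<^bsub>T\<^esub> \<ominus>\<^bsub>T\<^esub> ?e = ?x"
          using x e by (simp add: T.a_assoc T.r_neg)
        finally show ?thesis .
      qed
    qed auto
    finally show "t \<in> generate_ring T ?G" .
  qed
qed

end

section \<open>Transfer between the matrix ring and its diagonal\<close>

theorem theorem1p16:
  fixes n :: nat
    and D :: "nat \<Rightarrow> 'a ring"
    and M :: "nat \<Rightarrow> nat \<Rightarrow> ('a, 'a, 'a) bimodule"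
    and \<theta> :: "'a gm_theta"
    and T R :: "(nat \<times> nat \<Rightarrow> 'a) ring"
    and \<E> :: "(nat \<times> nat \<Rightarrow> 'a) set"
  assumes "class_T n D M \<theta>"
    and "T = gm_ring n D M \<theta>"
    and "R = T\<lparr>carrier := gm_diag n D M \<theta>\<rparr>"
    and "\<E> = (\<Union>k\<in>{1..n}. gm_E n D M \<theta> k)"
  shows "generate_ring T (carrier R \<union> \<E>) = carrier T
    \<and> (\<forall>C :: (nat \<times> nat \<Rightarrow> 'a) ring \<Rightarrow> bool.
        isomorphism_invariant C \<and> determined_by_prime_factors C \<longrightarrow> (C R \<longleftrightarrow> C T))
    \<and> (\<forall>\<M> :: 'u ring set.
        special_class \<M> \<longrightarrow> special_radical \<M> R = special_radical \<M> T \<inter> carrier R)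
    \<and> classical_Krull_dim R = classical_Krull_dim T"
proof -
  interpret class_T n D M \<theta> by fact
  have T: "T = gm_ring n D M \<theta>" by fact
  have R: "R = gm_ring n D M \<theta>\<lparr>carrier := gm_diag n D M \<theta>\<rparr>" by (simp only: assms)
  interpret hom: prime_reflecting_hom T R diag
    unfolding T R by (rule prime_reflecting_diag)
  have "generate_ring T (carrier R \<union> \<E>) = carrier T"
    unfolding T R \<open>\<E> = _\<close> by (rule generate_ring_diag_E)
  moreover have "C R \<longleftrightarrow> C T" if "determined_by_prime_factors C" for C
    using that hom.prime_factors_have_iff[of C] hom.R.ring_axioms hom.S.ring_axioms
    unfolding determined_by_prime_factors_def by blast
  moreover have "special_radical \<M> R = special_radical \<M> T \<inter> carrier R"
    if "special_class \<M>" for \<M> :: "'u ring set"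
  proof -
    have "x \<in> carrier T \<and> diag x = x" if "x \<in> carrier R" for x
      using that by (simp add: T R gm_diag_iff)
    then show ?thesis
      unfolding hom.special_radical_eq_preimage[OF that] hom.preimage_def
      by (auto simp: special_radical_def)
  qed
  ultimately show ?thesis
    using hom.classical_Krull_dim_eq by simp
qed

end
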